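(* Let $r:\mathbb{R}\to\mathbb{R}$ be bounded and continuously differentiable, with a bounded and uniformly continuous derivative $r'$. Let $(\varepsilon_t)_{t\ge 1}$ be i.i.d. real random variables with a probability density $f_\varepsilon$ that is positive everywhere and bounded below by a positive constant on every compact interval. Let $X_t=r(X_{t-1})+\varepsilon_t$, $t\ge1$, be the associated Markov chain, started from $X_0\sim\pi$ independent of $(\varepsilon_t)_{t\ge1}$, where $\pi$ is its unique invariant probability measure. Let $(X'_t)_{t\ge0}$ be the coupled copy and $D_t=X_t-X'_t$, $t\geq 1$, as defined in the context. Assume that $$\lambda:=\mathbb{E}\log|r'(X_0)|>0,\qquad \mathbb{E}\log_-|r'(X_0)|<\infty .$$ For $t\ge1$ set $$Q_t=\frac{|r(X_t)-r(X'_t)|}{|X_t-X'_t|}\,\mathbf{1}_{\{D_t\neq0\}} .$$ Suppose also that, for some $\delta_0>0$, $$\lim_{\eta\downarrow0}\ \sup_{t\ge2}\ \mathbb{E}\left[\log_-Q_t\ \mathbf{1}_{\{|r'(X_t)|\le\eta,\ |D_t|\le\delta_0\}}\right]=0 .$$ Then $$\mathbb{P}\left(\lim_{n\to\infty}D_n=0\right)=0 .$$ Additionally, for Lebesgue-almost every $(x,y)\in\mathbb{R}^2$, $$\mathbb{P}\left(\lim_{n\to\infty}\left|f_1^n(x)-f_1^n(y)\right|=0\right)=0,$$ where $f_t(x)=r(x)+\varepsilon_t$ and $f_1^n=f_n\circ f_{n-1}\circ\cdots\circ f_1$.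
   Context: Notation: $\log_-u=\max(-\log u,0)$ for $u>0$ and $\log_-0=+\infty$. Under the stated assumptions on $r$ and $f_\varepsilon$, the Markov chain $X_t=r(X_{t-1})+\varepsilon_t$ satisfies the Doeblin condition and is uniformly ergodic; in particular it has a unique invariant probability measure $\pi$, which has a positive density with respect to the Lebesgue measure. Coupled copy: let $\varepsilon'_1$ be a random variable with the same distribution as $\varepsilon_1$ and independent of $\sigma(X_0,\varepsilon_t:t\ge1)$. Define $$X'_0=X_0,\qquad X'_1=r(X_0)+\varepsilon'_1,\qquad X'_t=r(X'_{t-1})+\varepsilon_t\ \text{ for } t\ge2,$$ and $D_t=X_t-X'_t$ for $t\ge1$. Thus the two trajectories are driven by the same innovations except at time $1$. *)

theory Defs
  imports "HOL-Probability.Probability"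
begin

text \<open>Only used for \<open>u \<ge> 0\<close>. The case \<open>u = 0\<close> is separate because \<^term>\<open>ln (0::real)\<close> is \<open>0\<close>.\<close>

definition log_minus :: "real \<Rightarrow> ennreal" where
  "log_minus u = (if u = 0 then \<infinity> else ennreal (max (- ln u) 0))"

text \<open>The library's \<open>indep_var\<close> needs both variables to have the same type, so independence of
  a variable and a sequence is stated for the generated \<open>\<sigma>\<close>-algebras.\<close>

definition sigma_gen :: "'a measure \<Rightarrow> ('a \<Rightarrow> 'b) \<Rightarrow> 'b measure \<Rightarrow> 'a set set" where
  "sigma_gen M Z N = sets (vimage_algebra (space M) Z N)"

text \<open>The transition kernel of \<open>X\<^sub>t = r (X\<^sub>t\<^sub>-\<^sub>1) + \<epsilon>\<^sub>t\<close>, with \<open>f\<close> the density of the innovations.\<close>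

definition ar_kernel :: "(real \<Rightarrow> real) \<Rightarrow> (real \<Rightarrow> real) \<Rightarrow> real \<Rightarrow> real measure" where
  "ar_kernel r f x = distr (density lborel (\<lambda>e. ennreal (f e))) borel (\<lambda>e. r x + e)"

definition invariant_prob :: "(real \<Rightarrow> real measure) \<Rightarrow> real measure \<Rightarrow> bool" where
  "invariant_prob K \<mu> \<longleftrightarrow> prob_space \<mu> \<and> sets \<mu> = sets borel \<and>
     (\<forall>A\<in>sets borel. emeasure \<mu> A = (\<integral>\<^sup>+ x. emeasure (K x) A \<partial>\<mu>))"

text \<open>The remaining definitions are pathwise: \<open>e\<close> is a realisation of the innovations
  (\<open>e 0\<close> is never used) and \<open>e1'\<close> one of the independent copy of the first innovation.\<close>

fun chain :: "(real \<Rightarrow> real) \<Rightarrow> real \<Rightarrow> (nat \<Rightarrow> real) \<Rightarrow> nat \<Rightarrow> real" where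
  "chain r x0 e 0 = x0"
| "chain r x0 e (Suc t) = r (chain r x0 e t) + e (Suc t)"

fun coupled_chain :: "(real \<Rightarrow> real) \<Rightarrow> real \<Rightarrow> real \<Rightarrow> (nat \<Rightarrow> real) \<Rightarrow> nat \<Rightarrow> real" where
  "coupled_chain r x0 e1' e 0 = x0"
| "coupled_chain r x0 e1' e (Suc 0) = r x0 + e1'"
| "coupled_chain r x0 e1' e (Suc (Suc t)) = r (coupled_chain r x0 e1' e (Suc t)) + e (Suc (Suc t))"

definition diff_quot :: "(real \<Rightarrow> real) \<Rightarrow> real \<Rightarrow> real \<Rightarrow> real" where
  "diff_quot r x x' = \<bar>r x - r x'\<bar> / \<bar>x - x'\<bar> * (if x - x' \<noteq> 0 then 1 else 0)"

definition step_map :: "(real \<Rightarrow> real) \<Rightarrow> (nat \<Rightarrow> real) \<Rightarrow> nat \<Rightarrow> real \<Rightarrow> real" where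
  "step_map r e t x = r x + e t"

text \<open>\<open>flow r e n\<close> is \<open>f\<^sub>n \<circ> \<dots> \<circ> f\<^sub>1\<close>.\<close>

fun flow :: "(real \<Rightarrow> real) \<Rightarrow> (nat \<Rightarrow> real) \<Rightarrow> nat \<Rightarrow> real \<Rightarrow> real" where
  "flow r e 0 = id"
| "flow r e (Suc n) = step_map r e (Suc n) \<circ> flow r e n"

end

theory Submission imports Defs begin

text \<open>
  Along the two trajectories the distance obeys \<open>\<bar>D\<^sub>t\<^sub>+\<^sub>1\<bar> = Q\<^sub>t \<bar>D\<^sub>t\<bar>\<close>, so \<open>ln \<bar>D\<^sub>n\<bar>\<close> is a sum of terms
  \<open>ln Q\<^sub>t\<close>. When \<open>D\<^sub>t\<close> is small and \<open>\<bar>r' (X\<^sub>t)\<bar> > \<eta>\<close>, the mean value theorem and uniform continuity of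
  \<open>r'\<close> make \<open>ln Q\<^sub>t\<close> almost equal to \<open>ln \<bar>r' (X\<^sub>t)\<bar>\<close>. When \<open>\<bar>r' (X\<^sub>t)\<bar> \<le> \<eta>\<close> only the bound
  \<open>ln Q\<^sub>t \<ge> - log_minus Q\<^sub>t\<close> is available; this loss is what the uniform integrability hypothesis controls.
  If \<open>D\<^sub>n \<rightarrow> 0\<close>, then \<open>ln \<bar>D\<^sub>n\<bar> \<le> 0\<close> for large \<open>n\<close>, so the losses up to time \<open>n\<close> must eventually exceed
  the sum of the truncated logarithms \<open>ln \<bar>r' (X\<^sub>t)\<bar> 1{\<bar>r' (X\<^sub>t)\<bar> > \<eta>}\<close>, up to an error of order
  \<open>\<kappa> n\<close> (\<open>critical_losses_pay_for_expansion\<close>). The truncated logarithm is bounded and its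
  \<open>\<pi>\<close>-mean is at least \<open>\<lambda>\<close>, so the law of large numbers makes its sum at least \<open>n (\<lambda> - \<kappa>)\<close> with
  high probability. With \<open>\<kappa> = \<lambda> / 6\<close> the losses then exceed \<open>n \<lambda> / 2\<close>, which by Markov's inequality has
  probability at most \<open>2 s / \<lambda>\<close>, where \<open>s\<close> bounds the expected loss at each time. Hence
  \<open>P (D\<^sub>n \<rightarrow> 0) \<le> 2 s / \<lambda>\<close> (\<open>prob_tendsto_zero_le\<close>), and \<open>s \<rightarrow> 0\<close> as \<open>\<eta> \<down> 0\<close>.

  Two facts support this. The law of large numbers is proved in quadratic mean, for bounded
  functions: since \<open>r\<close> is bounded, all transition densities exceed a fixed positive constant on
  \<open>[0, 1]\<close>, so the kernel shrinks the oscillation of a function by a fixed factor, and correlations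
  along the chain decay geometrically (\<open>K_geometric_decay\<close>, \<open>X_second_moment\<close>).
  Moreover the logarithms make sense because the trajectories almost surely never meet after they
  have separated: \<open>r'\<close> vanishes only on a Lebesgue null set, hence preimages of null sets under \<open>r\<close> are
  null, and the law of \<open>(X\<^sub>t, X'\<^sub>t)\<close> stays absolutely continuous for all \<open>t \<ge> 1\<close>
  (\<open>AE_pair_if_AE_lborel\<close>).

  For the second claim, Lebesgue measure on the plane is absolutely continuous with respect to the law of
  \<open>(X\<^sub>1, X'\<^sub>1)\<close>, because innovation densities are positive. From time 1 on, both trajectories follow the
  flow of the innovations \<open>\<epsilon>\<^sub>2, \<epsilon>\<^sub>3, \<dots>\<close>, which are independent of \<open>(X\<^sub>1, X'\<^sub>1)\<close> and distributed like
  \<open>\<epsilon>\<^sub>1, \<epsilon>\<^sub>2, \<dots>\<close>. Fubini's theorem turns the almost sure statement for the coupled pair into one for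
  almost every pair of starting points (\<open>AE_flow_if_AE_coupled\<close>).
\<close>

section \<open>Independence and joint laws\<close>

text \<open>Unlike \<open>indep_var_distribution_eq\<close>, this allows the two functions to take values in
  different types.\<close>

lemma (in prob_space) indep_var_joint_law:
  assumes ind: "indep_var S X T Y"
    and [measurable]: "G \<in> measurable S N" "H \<in> measurable T N'"
  shows "distr M (N \<Otimes>\<^sub>M N') (\<lambda>\<omega>. (G (X \<omega>), H (Y \<omega>)))
       = distr M N (\<lambda>\<omega>. G (X \<omega>)) \<Otimes>\<^sub>M distr M N' (\<lambda>\<omega>. H (Y \<omega>))"
proof -
  have [measurable]: "X \<in> measurable M S" "Y \<in> measurable M T"
    using ind by (auto dest: indep_var_rv1 indep_var_rv2)
  interpret G: prob_space "distr M N (\<lambda>\<omega>. G (X \<omega>))" by (rule prob_space_distr) measurable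
  interpret H: prob_space "distr M N' (\<lambda>\<omega>. H (Y \<omega>))" by (rule prob_space_distr) measurable
  show ?thesis
  proof (rule pair_measure_eqI[symmetric])
    fix A B assume "A \<in> sets (distr M N (\<lambda>\<omega>. G (X \<omega>)))" "B \<in> sets (distr M N' (\<lambda>\<omega>. H (Y \<omega>)))"
    then have A[measurable]: "A \<in> sets N" and B[measurable]: "B \<in> sets N'" by auto
    have "prob ((\<lambda>\<omega>. (X \<omega>, Y \<omega>)) -` ((G -` A \<inter> space S) \<times> (H -` B \<inter> space T)) \<inter> space M)
        = prob (X -` (G -` A \<inter> space S) \<inter> space M) * prob (Y -` (H -` B \<inter> space T) \<inter> space M)"
      by (rule indep_varD[OF ind]) measurable
    also have "X -` (G -` A \<inter> space S) \<inter> space M = (\<lambda>\<omega>. G (X \<omega>)) -` A \<inter> space M"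
      using measurable_space[OF \<open>X \<in> measurable M S\<close>] by auto
    also have "Y -` (H -` B \<inter> space T) \<inter> space M = (\<lambda>\<omega>. H (Y \<omega>)) -` B \<inter> space M"
      using measurable_space[OF \<open>Y \<in> measurable M T\<close>] by auto
    also have "(\<lambda>\<omega>. (X \<omega>, Y \<omega>)) -` ((G -` A \<inter> space S) \<times> (H -` B \<inter> space T)) \<inter> space M
        = (\<lambda>\<omega>. (G (X \<omega>), H (Y \<omega>))) -` (A \<times> B) \<inter> space M"
      using measurable_space[OF \<open>X \<in> measurable M S\<close>] measurable_space[OF \<open>Y \<in> measurable M T\<close>]
      by auto
    finally show "emeasure (distr M N (\<lambda>\<omega>. G (X \<omega>))) A * emeasure (distr M N' (\<lambda>\<omega>. H (Y \<omega>))) B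
        = emeasure (distr M (N \<Otimes>\<^sub>M N') (\<lambda>\<omega>. (G (X \<omega>), H (Y \<omega>)))) (A \<times> B)"
      by (simp add: emeasure_distr emeasure_eq_measure ennreal_mult')
  qed (auto simp: G.sigma_finite_measure_axioms H.sigma_finite_measure_axioms)
qed

text \<open>Independence of a new variable from finite intersections of events of the family suffices,
  because these intersections already multiply among themselves.\<close>

lemma (in prob_space) indep_vars_insert:
  assumes ind: "indep_vars N W I" and i: "i \<notin> I" and rv: "W i \<in> measurable M (N i)"
    and fac: "\<And>A J B. A \<in> sets (N i) \<Longrightarrow> finite J \<Longrightarrow> J \<subseteq> I \<Longrightarrow> (\<And>j. j \<in> J \<Longrightarrow> B j \<in> sets (N j)) \<Longrightarrow>
       prob {\<omega>\<in>space M. W i \<omega> \<in> A \<and> (\<forall>j\<in>J. W j \<omega> \<in> B j)}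
       = prob {\<omega>\<in>space M. W i \<omega> \<in> A} * prob {\<omega>\<in>space M. \<forall>j\<in>J. W j \<omega> \<in> B j}"
  shows "indep_vars N W (insert i I)"
proof -
  have rvs: "W j \<in> measurable M (N j)" if "j \<in> insert i I" for j
    using that rv ind unfolding indep_vars_def2 by auto
  show ?thesis
    unfolding indep_vars_def2
  proof (intro conjI ballI rvs indep_setsI)
    fix j assume "j \<in> insert i I"
    then show "{W j -` A \<inter> space M |A. A \<in> sets (N j)} \<subseteq> events"
      using rvs by auto
  next
    fix E J assume J: "J \<noteq> {}" "J \<subseteq> insert i I" "finite J"
      and "\<forall>j\<in>J. E j \<in> {W j -` A \<inter> space M |A. A \<in> sets (N j)}"
    then have "\<forall>j\<in>J. \<exists>A. A \<in> sets (N j) \<and> E j = W j -` A \<inter> space M" by auto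
    then obtain B where B: "\<And>j. j \<in> J \<Longrightarrow> B j \<in> sets (N j)"
        "\<And>j. j \<in> J \<Longrightarrow> E j = W j -` B j \<inter> space M" by metis
    have sub: "prob (\<Inter>j\<in>K. E j) = (\<Prod>j\<in>K. prob (E j))" if "K \<subseteq> J - {i}" "K \<noteq> {}" for K
    proof -
      have K: "finite K" "K \<subseteq> I" "K \<subseteq> J" using that J by (auto intro: finite_subset[of K J])
      have "prob (\<Inter>j\<in>K. W j -` B j \<inter> space M) = (\<Prod>j\<in>K. prob (W j -` B j \<inter> space M))"
        by (rule indep_varsD[OF ind]) (use K that B in auto)
      moreover have "\<And>j. j \<in> K \<Longrightarrow> E j = W j -` B j \<inter> space M" using B K by auto
      ultimately show ?thesis by simp
    qed
    show "prob (\<Inter>j\<in>J. E j) = (\<Prod>j\<in>J. prob (E j))"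
    proof (cases "i \<in> J \<and> J - {i} \<noteq> {}")
      case True
      let ?K = "J - {i}"
      have eq1: "(\<Inter>j\<in>J. E j) = {\<omega>\<in>space M. W i \<omega> \<in> B i \<and> (\<forall>j\<in>?K. W j \<omega> \<in> B j)}"
        using True B by auto
      have eq2: "{\<omega>\<in>space M. \<forall>j\<in>?K. W j \<omega> \<in> B j} = (\<Inter>j\<in>?K. E j)"
        using True B by auto
      have eq3: "{\<omega>\<in>space M. W i \<omega> \<in> B i} = E i"
        using True B by auto
      have "prob (\<Inter>j\<in>J. E j) = prob (E i) * prob (\<Inter>j\<in>?K. E j)"
        unfolding eq1 eq2[symmetric] eq3[symmetric] using True J B by (intro fac) auto
      also have "prob (\<Inter>j\<in>?K. E j) = (\<Prod>j\<in>?K. prob (E j))"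
        using True by (intro sub) auto
      also have "prob (E i) * \<dots> = (\<Prod>j\<in>J. prob (E j))"
        using True J by (intro prod.remove[symmetric]) auto
      finally show ?thesis .
    next
      case False
      show ?thesis
      proof (cases "i \<in> J")
        case True
        with False have "J = {i}" by auto
        then show ?thesis by simp
      next
        case False
        with J show ?thesis by (intro sub) auto
      qed
    qed
  qed
qed

lemma (in prob_space) indep_vars_reindex_inj:
  assumes ind: "indep_vars N Z (\<phi> ` I)" and inj: "inj_on \<phi> I"
  shows "indep_vars (\<lambda>i. N (\<phi> i)) (\<lambda>i. Z (\<phi> i)) I"
  unfolding indep_vars_def2
proof (intro conjI ballI indep_setsI)
  show rv: "random_variable (N (\<phi> i)) (Z (\<phi> i))" if "i \<in> I" for i
    using ind that by (auto simp: indep_vars_def2)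
  show "{Z (\<phi> i) -` A \<inter> space M |A. A \<in> sets (N (\<phi> i))} \<subseteq> events" if "i \<in> I" for i
    using rv[OF that] by auto
  fix E J assume J: "J \<noteq> {}" "J \<subseteq> I" "finite J"
    and "\<forall>j\<in>J. E j \<in> {Z (\<phi> j) -` A \<inter> space M |A. A \<in> sets (N (\<phi> j))}"
  then have "\<forall>j\<in>J. \<exists>A. A \<in> sets (N (\<phi> j)) \<and> E j = Z (\<phi> j) -` A \<inter> space M" by auto
  then obtain B where B: "\<And>j. j \<in> J \<Longrightarrow> B j \<in> sets (N (\<phi> j))"
      "\<And>j. j \<in> J \<Longrightarrow> E j = Z (\<phi> j) -` B j \<inter> space M" by metis
  have inj': "inj_on \<phi> J" by (rule inj_on_subset[OF inj J(2)])
  have "prob (\<Inter>k\<in>\<phi>`J. Z k -` B (the_inv_into J \<phi> k) \<inter> space M)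
      = (\<Prod>k\<in>\<phi>`J. prob (Z k -` B (the_inv_into J \<phi> k) \<inter> space M))"
    by (rule indep_varsD[OF ind]) (use J B inj' in \<open>auto simp: the_inv_into_f_f\<close>)
  moreover have "(\<Inter>k\<in>\<phi>`J. Z k -` B (the_inv_into J \<phi> k) \<inter> space M) = (\<Inter>j\<in>J. E j)"
    using B(2) inj' by (auto simp: the_inv_into_f_f)
  moreover have "(\<Prod>k\<in>\<phi>`J. prob (Z k -` B (the_inv_into J \<phi> k) \<inter> space M)) = (\<Prod>j\<in>J. prob (E j))"
    using B(2) inj' by (simp add: prod.reindex the_inv_into_f_f)
  ultimately show "prob (\<Inter>j\<in>J. E j) = (\<Prod>j\<in>J. prob (E j))" by simp
qed

lemma in_sigma_gen: "S \<in> sets N \<Longrightarrow> Z -` S \<inter> space M \<in> sigma_gen M Z N"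
  unfolding sigma_gen_def by (rule in_vimage_algebra)

text \<open>The starting point, the resampled first innovation and the innovations form one independent
  sequence in this order: a step of either trajectory then uses a single member of the family whose
  index exceeds those used before.\<close>

definition noise_family :: "('a \<Rightarrow> real) \<Rightarrow> ('a \<Rightarrow> real) \<Rightarrow> (nat \<Rightarrow> 'a \<Rightarrow> real) \<Rightarrow> nat \<Rightarrow> 'a \<Rightarrow> real" where
  "noise_family X0 a \<epsilon> n = (case n of 0 \<Rightarrow> X0 | Suc m \<Rightarrow> (case m of 0 \<Rightarrow> a | Suc k \<Rightarrow> \<epsilon> (Suc k)))"

lemma noise_family_simps:
  shows "noise_family X0 a \<epsilon> 0 = X0" and "noise_family X0 a \<epsilon> 1 = a"
    and "n \<ge> 2 \<Longrightarrow> noise_family X0 a \<epsilon> n = \<epsilon> (n - 1)"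
  by (auto simp: noise_family_def split: nat.split)

lemma (in prob_space) indep_noise_family:
  fixes X0 a :: "'a \<Rightarrow> real" and \<epsilon> :: "nat \<Rightarrow> 'a \<Rightarrow> real"
  assumes X0_measurable[measurable]: "X0 \<in> borel_measurable M"
    and a_measurable[measurable]: "a \<in> borel_measurable M"
    and ind_\<epsilon>: "indep_vars (\<lambda>_. borel) \<epsilon> {1..}"
    and ind_X0: "indep_set (sigma_gen M X0 borel)
      (sigma_gen M (\<lambda>\<omega>. \<lambda>t\<in>{1..}. \<epsilon> t \<omega>) (PiM {1..} (\<lambda>_. borel)))"
    and ind_a: "indep_set (sigma_gen M a borel)
      (sigma_gen M (\<lambda>\<omega>. (X0 \<omega>, \<lambda>t\<in>{1..}. \<epsilon> t \<omega>)) (borel \<Otimes>\<^sub>M PiM {1..} (\<lambda>_. borel)))"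
  shows "indep_vars (\<lambda>_. borel) (noise_family X0 a \<epsilon>) UNIV"
proof -
  define W where "W = noise_family X0 a \<epsilon>"
  have W: "W 0 = X0" "W 1 = a" "\<And>n. n \<ge> 2 \<Longrightarrow> W n = \<epsilon> (n - 1)"
    unfolding W_def by (rule noise_family_simps; assumption)+
  have "indep_vars (\<lambda>_. borel) (\<lambda>n. \<epsilon> (n - 1)) {2..}"
  proof (rule indep_vars_reindex_inj[where \<phi>="\<lambda>n. n - 1" and N="\<lambda>_. borel" and Z=\<epsilon>])
    show "indep_vars (\<lambda>_. borel) \<epsilon> ((\<lambda>n. n - 1) ` {2..})"
      by (rule indep_vars_subset[OF ind_\<epsilon>]) auto
  qed (auto simp: inj_on_def)
  then have ind2: "indep_vars (\<lambda>_. borel) W {2..}"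
    by (subst indep_vars_cong[OF refl _ refl, where Y="\<lambda>n. \<epsilon> (n - 1)"]) (auto simp: W)
  have ind0: "indep_vars (\<lambda>_. borel) W (insert 0 {2..})"
  proof (rule indep_vars_insert[OF ind2])
    fix A :: "real set" and J :: "nat set" and B :: "nat \<Rightarrow> real set"
    assume A: "A \<in> sets borel" and J: "finite J" "J \<subseteq> {2..}" and B: "\<And>j. j \<in> J \<Longrightarrow> B j \<in> sets borel"
    let ?Z = "\<lambda>\<omega>. \<lambda>t\<in>{1..}. \<epsilon> t \<omega>"
    let ?S = "{w \<in> space (PiM {1..} (\<lambda>_. borel)). \<forall>j\<in>J. w (j - 1) \<in> B j}"
    have S: "?S \<in> sets (PiM {1..} (\<lambda>_. borel))"
    proof (intro sets.sets_Collect_finite_All J(1))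
      fix j assume "j \<in> J"
      then have [measurable]: "B j \<in> sets borel" "(\<lambda>w. w (j - 1)) \<in> borel_measurable (PiM {1..} (\<lambda>_. borel))"
        using B J by (auto intro!: measurable_component_singleton)
      show "{w \<in> space (PiM {1..} (\<lambda>_. borel)). w (j - 1) \<in> B j} \<in> sets (PiM {1..} (\<lambda>_. borel :: real measure))"
        by measurable
    qed
    have factor: "prob ((X0 -` A \<inter> space M) \<inter> (?Z -` ?S \<inter> space M)) = prob (X0 -` A \<inter> space M) * prob (?Z -` ?S \<inter> space M)"
      by (rule indep_setD[OF ind_X0 in_sigma_gen[OF A] in_sigma_gen[OF S]])
    have eqS: "?Z -` ?S \<inter> space M = {\<omega>\<in>space M. \<forall>j\<in>J. W j \<omega> \<in> B j}"
    proof -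
      have "?Z \<omega> (j - 1) = W j \<omega>" if "j \<in> J" for j \<omega>
      proof -
        from that J have "j \<ge> 2" by auto
        then show ?thesis by (auto simp: W(3))
      qed
      then show ?thesis by (auto simp: space_PiM)
    qed
    have eqA: "X0 -` A \<inter> space M = {\<omega>\<in>space M. W 0 \<omega> \<in> A}" by (auto simp: W)
    have eqI: "{\<omega>\<in>space M. W 0 \<omega> \<in> A} \<inter> {\<omega>\<in>space M. \<forall>j\<in>J. W j \<omega> \<in> B j}
        = {\<omega>\<in>space M. W 0 \<omega> \<in> A \<and> (\<forall>j\<in>J. W j \<omega> \<in> B j)}" by auto
    show "prob {\<omega>\<in>space M. W 0 \<omega> \<in> A \<and> (\<forall>j\<in>J. W j \<omega> \<in> B j)}
        = prob {\<omega>\<in>space M. W 0 \<omega> \<in> A} * prob {\<omega>\<in>space M. \<forall>j\<in>J. W j \<omega> \<in> B j}"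
      using factor unfolding eqA eqS eqI .
  qed (auto simp: W)
  have "indep_vars (\<lambda>_. borel) W (insert 1 (insert 0 {2..}))"
  proof (rule indep_vars_insert[OF ind0])
    fix A :: "real set" and J :: "nat set" and B :: "nat \<Rightarrow> real set"
    assume A: "A \<in> sets borel" and J: "finite J" "J \<subseteq> insert 0 {2..}" and B: "\<And>j. j \<in> J \<Longrightarrow> B j \<in> sets borel"
    let ?N = "borel \<Otimes>\<^sub>M PiM {1..} (\<lambda>_. borel) :: (real \<times> (nat \<Rightarrow> real)) measure"
    let ?Z = "\<lambda>\<omega>. (X0 \<omega>, \<lambda>t\<in>{1..}. \<epsilon> t \<omega>)"
    let ?S = "{p \<in> space ?N. \<forall>j\<in>J. (if j = 0 then fst p else snd p (j - 1)) \<in> B j}"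
    have S: "?S \<in> sets ?N"
    proof (intro sets.sets_Collect_finite_All J(1))
      fix j assume j: "j \<in> J"
      then have [measurable]: "B j \<in> sets borel" using B by simp
      have "(\<lambda>p. snd p (j - 1)) \<in> borel_measurable ?N" if "j \<noteq> 0"
      proof -
        have "j - 1 \<in> {1..}" using j J that by auto
        then show ?thesis
          by (rule measurable_compose[OF measurable_snd measurable_component_singleton])
      qed
      then have [measurable]: "(\<lambda>p. if j = 0 then fst p else snd p (j - 1)) \<in> borel_measurable ?N"
        by (cases "j = 0") (simp_all del: One_nat_def)
      show "{p \<in> space ?N. (if j = 0 then fst p else snd p (j - 1)) \<in> B j} \<in> sets ?N"
        by measurable
    qed
    have factor: "prob ((a -` A \<inter> space M) \<inter> (?Z -` ?S \<inter> space M)) = prob (a -` A \<inter> space M) * prob (?Z -` ?S \<inter> space M)"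
      by (rule indep_setD[OF ind_a in_sigma_gen[OF A] in_sigma_gen[OF S]])
    have eqS: "?Z -` ?S \<inter> space M = {\<omega>\<in>space M. \<forall>j\<in>J. W j \<omega> \<in> B j}"
    proof -
      have "(if j = 0 then fst (?Z \<omega>) else snd (?Z \<omega>) (j - 1)) = W j \<omega>" if "j \<in> J" for j \<omega>
      proof (cases "j = 0")
        case False
        with that J have "j \<ge> 2" by auto
        then show ?thesis by (auto simp: W(3))
      qed (simp add: W(1))
      then have "{\<omega>\<in>space M. \<forall>j\<in>J. W j \<omega> \<in> B j} = {\<omega>\<in>space M. \<forall>j\<in>J.
          (if j = 0 then fst (?Z \<omega>) else snd (?Z \<omega>) (j - 1)) \<in> B j}"
        by (intro Collect_cong conj_cong refl ball_cong) (simp only:)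
      moreover have "?Z \<omega> \<in> space ?N" for \<omega>
        by (simp add: space_pair_measure space_PiM)
      ultimately show ?thesis by blast
    qed
    have eqA: "a -` A \<inter> space M = {\<omega>\<in>space M. W 1 \<omega> \<in> A}" unfolding W(2) by auto
    have eqI: "{\<omega>\<in>space M. W 1 \<omega> \<in> A} \<inter> {\<omega>\<in>space M. \<forall>j\<in>J. W j \<omega> \<in> B j}
        = {\<omega>\<in>space M. W 1 \<omega> \<in> A \<and> (\<forall>j\<in>J. W j \<omega> \<in> B j)}" by auto
    show "prob {\<omega>\<in>space M. W 1 \<omega> \<in> A \<and> (\<forall>j\<in>J. W j \<omega> \<in> B j)}
        = prob {\<omega>\<in>space M. W 1 \<omega> \<in> A} * prob {\<omega>\<in>space M. \<forall>j\<in>J. W j \<omega> \<in> B j}"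
      using factor unfolding eqA eqS eqI .
  qed (auto simp: W(2)[unfolded One_nat_def])
  moreover have "insert 1 (insert 0 {2..}) = (UNIV :: nat set)" by auto
  ultimately show ?thesis unfolding W_def by simp
qed

section \<open>Preimages of Lebesgue null sets\<close>

text \<open>Near a point where \<open>r'\<close> does not vanish, \<open>r\<close> expands distances by at least a positive factor,
  so it has a Lipschitz local inverse; such a map sends null sets to null sets, and locally negligible
  sets are negligible.\<close>

lemma negligible_vimage_nonzero_deriv:
  fixes r r' :: "real \<Rightarrow> real"
  assumes deriv: "\<And>x. (r has_real_derivative r' x) (at x)" and cont: "continuous_on UNIV r'"
    and N: "negligible N" and crit: "negligible {x. r' x = 0}"
  shows "negligible (r -` N)"
proof -
  let ?E = "r -` N \<inter> {x. r' x \<noteq> 0}"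
  have "negligible ?E"
  proof (subst locally_negligible_alt, intro ballI)
    fix x assume x: "x \<in> ?E"
    define c where "c = \<bar>r' x\<bar> / 2"
    have c: "c > 0" using x by (simp add: c_def)
    have "isCont r' x" using cont by (simp add: continuous_on_eq_continuous_at)
    then obtain d where d: "d > 0" "\<And>y. \<bar>y - x\<bar> < d \<Longrightarrow> \<bar>r' y - r' x\<bar> < c"
      using c unfolding continuous_at_eps_delta dist_real_def by metis
    let ?U = "ball x d"
    have big: "c \<le> \<bar>r' y\<bar>" if "y \<in> ?U" for y
    proof -
      have "\<bar>r' y - r' x\<bar> < c" using d(2)[of y] that by (simp add: dist_real_def abs_minus_commute)
      then show ?thesis unfolding c_def by linarith
    qed
    have exp: "c * \<bar>y - z\<bar> \<le> \<bar>r y - r z\<bar>" if yz: "y \<in> ?U" "z \<in> ?U" for y z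
    proof -
      have main: "c * \<bar>b - a\<bar> \<le> \<bar>r b - r a\<bar>" if "a < b" "a \<in> ?U" "b \<in> ?U" for a b
      proof -
        obtain w where w: "a < w" "w < b" "r b - r a = (b - a) * r' w"
          using MVT2[OF \<open>a < b\<close>, of r r'] deriv by auto
        have "w \<in> ?U" using w that by (auto simp: dist_real_def abs_if split: if_splits)
        from big[OF this] show ?thesis
          using w(3) \<open>a < b\<close> by (simp add: abs_mult mult.commute mult_left_mono)
      qed
      consider "y = z" | "y < z" | "z < y" by linarith
      then show ?thesis
      proof cases
        case 2 then show ?thesis using main[of y z] yz by (simp add: abs_minus_commute)
      next
        case 3 then show ?thesis using main[of z y] yz by simp
      qed simp
    qed
    have inj: "inj_on r ?U"
    proof (rule inj_onI)
      fix y z assume "y \<in> ?U" "z \<in> ?U" "r y = r z"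
      then have "c * \<bar>y - z\<bar> \<le> 0" using exp[of y z] by simp
      then show "y = z" using c by (simp add: mult_le_0_iff)
    qed
    let ?F = "r ` (?E \<inter> ?U)"
    have F: "negligible ?F" by (rule negligible_subset[OF N]) auto
    have "negligible (inv_into ?U r ` ?F)"
    proof (rule negligible_locally_Lipschitz_image[OF _ F])
      fix u assume "u \<in> ?F"
      then obtain y where y: "y \<in> ?U" "u = r y" by auto
      have "norm (inv_into ?U r v - inv_into ?U r u) \<le> (1/c) * norm (v - u)" if "v \<in> ?F" for v
      proof -
        from that obtain z where z: "z \<in> ?U" "v = r z" by auto
        show ?thesis using exp[OF z(1) y(1)] y z inj c by (simp add: field_simps)
      qed
      then show "\<exists>T B. open T \<and> u \<in> T \<and>
          (\<forall>v\<in>?F \<inter> T. norm (inv_into ?U r v - inv_into ?U r u) \<le> B * norm (v - u))"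
        by (intro exI[of _ UNIV] exI[of _ "1/c"]) auto
    qed simp
    moreover have "inv_into ?U r ` ?F = ?E \<inter> ?U"
      using inj by (simp add: inv_into_image_cancel)
    ultimately have "negligible (?E \<inter> ?U)" by simp
    then show "\<exists>U. openin (top_of_set ?E) U \<and> x \<in> U \<and> negligible U"
      using x d by (intro exI[of _ "?E \<inter> ?U"]) (auto simp: openin_open)
  qed
  from negligible_Un[OF this crit] show ?thesis
    by (rule negligible_subset) auto
qed

text \<open>Holds for arbitrary, possibly non-measurable, properties, which spares measurability
  conditions when almost everywhere statements are pulled back along \<open>r\<close>.\<close>

lemma AE_lborel_iff_negligible: "(AE x in lborel. P x) \<longleftrightarrow> negligible {x::real. \<not> P x}"
proof -
  have "(AE x in lborel. P x) \<longleftrightarrow> (AE x in (lebesgue::real measure). P x)"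
    by (simp add: AE_completion_iff)
  also have "\<dots> \<longleftrightarrow> {x. \<not> P x} \<in> null_sets lebesgue"
    by (simp add: AE_iff_null_sets completion.complete2 eventually_ae_filter) 
      (auto intro: completion.complete2)
  finally show ?thesis by (simp add: negligible_iff_null_sets)
qed

lemma AE_lborel_compose:
  fixes r r' :: "real \<Rightarrow> real"
  assumes deriv: "\<And>x. (r has_real_derivative r' x) (at x)" and cont: "continuous_on UNIV r'"
    and crit: "AE x in lborel. r' x \<noteq> 0" and P: "AE y in lborel. P y"
  shows "AE x in lborel. P (r x)"
proof -
  have "negligible (r -` {y. \<not> P y})"
    using P crit by (intro negligible_vimage_nonzero_deriv[OF deriv cont])
      (simp_all add: AE_lborel_iff_negligible)
  then show ?thesis by (simp add: AE_lborel_iff_negligible vimage_def)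
qed

lemma AE_lborel_shift_iff:
  fixes c :: real
  shows "(AE x in lborel. P (c + x)) \<longleftrightarrow> (AE x in lborel. P x)"
proof -
  have shift: "AE x in lborel. P (d + x)" if "AE x in lborel. P x" for d and P :: "real \<Rightarrow> bool"
    by (rule AE_lborel_compose[where r'="\<lambda>_. 1", OF _ _ _ that])
      (auto intro!: derivative_eq_intros)
  show ?thesis
    using shift[of P c] shift[of "\<lambda>x. P (c + x)" "- c"] by (intro iffI) simp_all
qed

section \<open>The transition operator and its contraction\<close>

locale ar_model =
  fixes r r' f :: "real \<Rightarrow> real" and \<pi> :: "real measure"
  assumes r_bounded: "bounded (range r)"
    and r_deriv: "\<And>x. (r has_real_derivative r' x) (at x)"
    and r'_bounded: "bounded (range r')"
    and r'_ucont: "uniformly_continuous_on UNIV r'"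
    and f_measurable: "(\<lambda>x. ennreal (f x)) \<in> borel_measurable borel"
    and f_pos: "\<And>x. f x > 0"
    and f_lower: "\<And>a b. a \<le> b \<Longrightarrow> \<exists>c>0. \<forall>x\<in>{a..b}. c \<le> f x"
    and prob_space_innovation: "prob_space (density lborel (\<lambda>x. ennreal (f x)))"
    and invariant: "invariant_prob (ar_kernel r f) \<pi>"
begin

abbreviation \<nu> :: "real measure" where "\<nu> \<equiv> density lborel (\<lambda>x. ennreal (f x))"

sublocale \<nu>: prob_space \<nu> by (rule prob_space_innovation)
sublocale \<pi>: prob_space \<pi> using invariant by (simp add: invariant_prob_def)
sublocale \<pi>\<nu>: pair_prob_space \<pi> \<nu> ..

lemma sets_\<pi>[measurable_cong, simp]: "sets \<pi> = sets borel"
  using invariant by (simp add: invariant_prob_def)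

lemma space_\<pi>[simp]: "space \<pi> = UNIV"
  using sets_eq_imp_space_eq[OF sets_\<pi>] by simp

lemma measure_innovation_UNIV[simp]: "measure \<nu> UNIV = 1"
  using \<nu>.prob_space by simp

lemma continuous_r': "continuous_on UNIV r'"
  by (rule uniformly_continuous_imp_continuous[OF r'_ucont])

lemma r'_measurable[measurable]: "r' \<in> borel_measurable borel"
  by (rule borel_measurable_continuous_onI[OF continuous_r'])

lemma r_measurable[measurable]: "r \<in> borel_measurable borel"
proof (rule borel_measurable_continuous_onI)
  show "continuous_on UNIV r"
    using DERIV_isCont[OF r_deriv] by (simp add: continuous_at_imp_continuous_on)
qed

lemma f_real_measurable[measurable]: "f \<in> borel_measurable borel"
proof -
  have "(\<lambda>x. enn2real (ennreal (f x))) \<in> borel_measurable borel"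
    using f_measurable by measurable
  then show ?thesis using f_pos by (simp add: less_imp_le)
qed

lemma AE_innovation_iff: "(AE e in \<nu>. P e) \<longleftrightarrow> (AE e in lborel. P e)"
  by (subst AE_density) (use f_measurable f_pos in auto)

text \<open>Turns invariance, which is given for sets, into a form to which Fubini's theorem applies for
  integrals of functions.\<close>

lemma invariant_law: "distr (\<pi> \<Otimes>\<^sub>M \<nu>) borel (\<lambda>(x, e). r x + e) = \<pi>"
proof (rule measure_eqI)
  fix A assume "A \<in> sets (distr (\<pi> \<Otimes>\<^sub>M \<nu>) borel (\<lambda>(x, e). r x + e))"
  then have A[measurable]: "A \<in> sets borel" by simp
  have "emeasure (distr (\<pi> \<Otimes>\<^sub>M \<nu>) borel (\<lambda>(x, e). r x + e)) A
      = emeasure (\<pi> \<Otimes>\<^sub>M \<nu>) ((\<lambda>(x, e). r x + e) -` A \<inter> space (\<pi> \<Otimes>\<^sub>M \<nu>))"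
    by (rule emeasure_distr) measurable
  also have "\<dots> = (\<integral>\<^sup>+ x. emeasure \<nu> (Pair x -` ((\<lambda>(x, e). r x + e) -` A \<inter> space (\<pi> \<Otimes>\<^sub>M \<nu>))) \<partial>\<pi>)"
    by (rule \<nu>.emeasure_pair_measure_alt) measurable
  also have "\<dots> = (\<integral>\<^sup>+ x. emeasure (ar_kernel r f x) A \<partial>\<pi>)"
    unfolding ar_kernel_def
    by (intro nn_integral_cong) (simp add: emeasure_distr space_pair_measure vimage_def)
  also have "\<dots> = emeasure \<pi> A"
    using invariant A by (simp add: invariant_prob_def)
  finally show "emeasure (distr (\<pi> \<Otimes>\<^sub>M \<nu>) borel (\<lambda>(x, e). r x + e)) A = emeasure \<pi> A" .
qed simp

text \<open>The innovation density is positive, so a set that is null for \<open>\<pi>\<close>, hence null after one step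
  from some point, is a Lebesgue null set up to a translation.\<close>

lemma lborel_absolutely_continuous:
  assumes "AE x in \<pi>. P x"
  shows "AE x in lborel. P x"
proof -
  from assms obtain N where N: "{x. \<not> P x} \<subseteq> N" "N \<in> sets borel" "emeasure \<pi> N = 0"
    by (auto elim!: AE_E)
  have N'[measurable]: "N \<in> sets borel" by fact
  have "AE y in distr (\<pi> \<Otimes>\<^sub>M \<nu>) borel (\<lambda>(x, e). r x + e). y \<notin> N"
    unfolding invariant_law using N by (intro AE_not_in) (auto simp: null_sets_def)
  then have "AE z in \<pi> \<Otimes>\<^sub>M \<nu>. (case z of (x, e) \<Rightarrow> r x + e) \<notin> N"
    by (subst (asm) AE_distr_iff) auto
  from \<pi>\<nu>.AE_pair[OF this] have "AE x in \<pi>. AE e in \<nu>. r x + e \<notin> N" by simp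
  have "\<exists>x. AE e in \<nu>. r x + e \<notin> N"
  proof (rule ccontr)
    assume "\<nexists>x. AE e in \<nu>. r x + e \<notin> N"
    with \<open>AE x in \<pi>. AE e in \<nu>. r x + e \<notin> N\<close> have "AE x in \<pi>. False" by simp
    then show False by simp
  qed
  then obtain x where "AE e in \<nu>. r x + e \<notin> N" by blast
  then have "AE e in lborel. e \<notin> N"
    unfolding AE_innovation_iff by (subst (asm) AE_lborel_shift_iff)
  with N(1) show ?thesis by (auto elim!: eventually_mono)
qed

text \<open>The transition operator of the chain on functions.\<close>

definition K :: "(real \<Rightarrow> real) \<Rightarrow> real \<Rightarrow> real" where
  "K g x = (\<integral>e. g (r x + e) \<partial>\<nu>)"

lemma K_measurable[measurable]:
  assumes [measurable]: "g \<in> borel_measurable borel"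
  shows "K g \<in> borel_measurable borel"
  unfolding K_def by measurable

lemma integrable_innovation:
  assumes [measurable]: "g \<in> borel_measurable borel" and "\<And>x. a \<le> g x" "\<And>x. g x \<le> (b::real)"
  shows "integrable \<nu> (\<lambda>e. g (c + e))"
proof (rule \<nu>.integrable_const_bound[where B="max \<bar>a\<bar> \<bar>b\<bar>"])
  have "\<bar>g x\<bar> \<le> max \<bar>a\<bar> \<bar>b\<bar>" for x
    using assms(2)[of x] assms(3)[of x] by linarith
  then show "AE e in \<nu>. norm (g (c + e)) \<le> max \<bar>a\<bar> \<bar>b\<bar>" by simp
qed measurable

lemma integral_K:
  assumes [measurable]: "g \<in> borel_measurable borel" and "\<And>x. a \<le> g x" "\<And>x. g x \<le> b"
  shows "(\<integral>x. K g x \<partial>\<pi>) = (\<integral>x. g x \<partial>\<pi>)"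
proof -
  have "integrable (\<pi> \<Otimes>\<^sub>M \<nu>) (\<lambda>(x, e). g (r x + e))"
  proof (rule \<pi>\<nu>.integrable_const_bound[where B="max \<bar>a\<bar> \<bar>b\<bar>"])
    have "\<bar>g x\<bar> \<le> max \<bar>a\<bar> \<bar>b\<bar>" for x
      using assms(2)[of x] assms(3)[of x] by linarith
    then show "AE z in \<pi> \<Otimes>\<^sub>M \<nu>. norm (case z of (x, e) \<Rightarrow> g (r x + e)) \<le> max \<bar>a\<bar> \<bar>b\<bar>" by auto
  qed measurable
  from \<pi>\<nu>.integral_fst[OF this]
  have "(\<integral>x. K g x \<partial>\<pi>) = (\<integral>z. g (case z of (x, e) \<Rightarrow> r x + e) \<partial>(\<pi> \<Otimes>\<^sub>M \<nu>))"
    unfolding K_def by (simp add: case_prod_unfold)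
  also have "\<dots> = (\<integral>x. g x \<partial>distr (\<pi> \<Otimes>\<^sub>M \<nu>) borel (\<lambda>(x, e). r x + e))"
    by (rule integral_distr[symmetric]) measurable
  finally show ?thesis unfolding invariant_law .
qed

text \<open>Doeblin's condition: as \<open>\<bar>r\<bar> \<le> R\<close>, an innovation that moves the chain into \<open>[0, 1]\<close> lies in
  \<open>[-R, R + 1]\<close>, where its density has a positive lower bound that is the same for all starting points.\<close>

lemma doeblin_minorization:
  "\<exists>c>0. \<forall>u b x. u \<in> borel_measurable borel \<longrightarrow> (\<forall>z. 0 \<le> u z \<and> u z \<le> b)
     \<longrightarrow> c * (\<integral>z. indicator {0..1} z * u z \<partial>lborel) \<le> K u x"
proof -
  obtain R where R: "\<And>x. \<bar>r x\<bar> \<le> R"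
    using r_bounded by (auto simp: bounded_iff)
  then have "R \<ge> 0" using R[of 0] by linarith
  then obtain c where c: "c > 0" "\<And>x. x \<in> {-R..R+1} \<Longrightarrow> c \<le> f x"
    using f_lower[of "-R" "R+1"] by auto
  have "c * (\<integral>z. indicator {0..1} z * u z \<partial>lborel) \<le> K u x"
    if [measurable]: "u \<in> borel_measurable borel" and u: "\<And>z. 0 \<le> u z" "\<And>z. u z \<le> b" for u b x
  proof -
    have int: "integrable lborel (\<lambda>e. f e * u (r x + e))"
      using integrable_innovation[of u 0 b "r x"] u f_pos
      by (subst (asm) integrable_density) (auto simp: less_imp_le)
    have ub: "\<bar>u z\<bar> \<le> \<bar>b\<bar>" for z using u(1)[of z] u(2)[of z] by linarith
    have "integrable lborel (\<lambda>z. indicator {0..1::real} z * u z)"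
    proof (rule Bochner_Integration.integrable_bound)
      show "integrable lborel (\<lambda>z. indicator {0..1::real} z * b)" by simp
      show "AE z in lborel. norm (indicator {0..1} z * u z) \<le> norm (indicator {0..1::real} z * b)"
        using ub by (auto split: split_indicator)
    qed measurable
    then have int': "integrable lborel (\<lambda>e. indicator {0..1::real} (r x + e) * u (r x + e))"
      using lborel_integrable_real_affine[of "\<lambda>z. indicator {0..1::real} z * u z" 1 "r x"] by simp
    have "c * (\<integral>z. indicator {0..1} z * u z \<partial>lborel)
        = (\<integral>e. c * (indicator {0..1} (r x + e) * u (r x + e)) \<partial>lborel)"
      using lborel_integral_real_affine[of 1 "\<lambda>z. indicator {0..1} z * u z" "r x"] by simp
    also have "\<dots> \<le> (\<integral>e. f e * u (r x + e) \<partial>lborel)"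
    proof (rule integral_mono)
      fix e
      show "c * (indicator {0..1} (r x + e) * u (r x + e)) \<le> f e * u (r x + e)"
      proof (cases "r x + e \<in> {0..1}")
        case True
        then have "e \<in> {-R..R+1}" using R[of x] by auto
        then show ?thesis using True c u by (auto intro!: mult_right_mono)
      next
        case False
        then show ?thesis using u f_pos[of e] by (simp add: less_imp_le)
      qed
    qed (use int int' in auto)
    also have "\<dots> = K u x"
      unfolding K_def using f_pos by (subst integral_density) (auto simp: less_imp_le)
    finally show ?thesis .
  qed
  with c(1) show ?thesis by blast
qed

text \<open>Apply the minorization to \<open>g - a\<close> and \<open>b - g\<close>. Both give a gain in terms of the same number
  \<open>I = \<integral>\<^bsub>[0,1]\<^esub> g\<close>, and the two gains add up to \<open>c (b - a)\<close>.\<close>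

lemma K_contracts_oscillation:
  "\<exists>c. 0 < c \<and> c \<le> 1 \<and> (\<forall>g a b. g \<in> borel_measurable borel \<longrightarrow> (\<forall>x. a \<le> g x \<and> g x \<le> b)
     \<longrightarrow> (\<exists>a' b'. (\<forall>x. a' \<le> K g x \<and> K g x \<le> b') \<and> b' - a' = (1 - c) * (b - a)))"
proof -
  obtain c where c: "c > 0" and minor': "\<forall>u b x. u \<in> borel_measurable borel \<longrightarrow> (\<forall>z. 0 \<le> u z \<and> u z \<le> b)
     \<longrightarrow> c * (\<integral>z. indicator {0..1} z * u z \<partial>lborel) \<le> K u x"
    using doeblin_minorization by blast
  note minor = minor'[rule_format]
  have "c \<le> 1"
    using minor[of "\<lambda>_. 1" 1 0] by (simp add: K_def)
  moreover have "\<exists>a' b'. (\<forall>x. a' \<le> K g x \<and> K g x \<le> b') \<and> b' - a' = (1 - c) * (b - a)"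
    if [measurable]: "g \<in> borel_measurable borel" and g: "\<And>x. a \<le> g x" "\<And>x. g x \<le> b" for g a b
  proof -
    define I where "I = (\<integral>z. indicator {0..1} z * g z \<partial>lborel)"
    have int1: "integrable lborel (\<lambda>z. indicator {0..1::real} z * d)" for d :: real by simp
    have "integrable lborel (\<lambda>z. indicator {0..1::real} z * g z)"
    proof (rule Bochner_Integration.integrable_bound)
      show "integrable lborel (\<lambda>z. indicator {0..1::real} z * max \<bar>a\<bar> \<bar>b\<bar>)" by simp
      have "\<bar>g x\<bar> \<le> max \<bar>a\<bar> \<bar>b\<bar>" for x
        using g(1)[of x] g(2)[of x] by linarith
      then show "AE z in lborel. norm (indicator {0..1} z * g z) \<le> norm (indicator {0..1::real} z * max \<bar>a\<bar> \<bar>b\<bar>)"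
        by (auto split: split_indicator)
    qed measurable
    note int = this
    have "a + c * (I - a) \<le> K g x" for x
    proof -
      have "c * (\<integral>z. indicator {0..1} z * (g z - a) \<partial>lborel) \<le> K (\<lambda>z. g z - a) x"
        using g by (intro minor[of _ "b - a"]) auto
      moreover have "(\<integral>z. indicator {0..1} z * (g z - a) \<partial>lborel) = I - a"
        using int int1[of a] by (simp add: I_def right_diff_distrib)
      moreover have "K (\<lambda>z. g z - a) x = K g x - a"
        unfolding K_def using integrable_innovation[of g a b] g by simp
      ultimately show ?thesis by simp
    qed
    moreover have "K g x \<le> b - c * (b - I)" for x
    proof -
      have "c * (\<integral>z. indicator {0..1} z * (b - g z) \<partial>lborel) \<le> K (\<lambda>z. b - g z) x"
        using g by (intro minor[of _ "b - a"]) auto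
      moreover have "(\<integral>z. indicator {0..1} z * (b - g z) \<partial>lborel) = b - I"
        using int int1[of b] by (simp add: I_def right_diff_distrib)
      moreover have "K (\<lambda>z. b - g z) x = b - K g x"
        unfolding K_def using integrable_innovation[of g a b] g by simp
      ultimately show ?thesis by simp
    qed
    ultimately show ?thesis
      by (intro exI[of _ "a + c * (I - a)"] exI[of _ "b - c * (b - I)"]) (auto simp: algebra_simps)
  qed
  ultimately show ?thesis using c by blast
qed

text \<open>All iterates have \<open>\<pi>\<close>-mean zero, so the interval that contains the values of an iterate
  contains \<open>0\<close>; its length bounds the iterate.\<close>

lemma K_geometric_decay:
  "\<exists>\<rho>. 0 \<le> \<rho> \<and> \<rho> < 1 \<and> (\<forall>g B n x. g \<in> borel_measurable borel \<longrightarrow> (\<forall>x. \<bar>g x\<bar> \<le> B)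
     \<longrightarrow> (\<integral>x. g x \<partial>\<pi>) = 0 \<longrightarrow> \<bar>(K ^^ n) g x\<bar> \<le> 2 * B * \<rho> ^ n)"
proof -
  obtain c where c: "0 < c" "c \<le> 1" and contr: "\<forall>g a b. g \<in> borel_measurable borel \<longrightarrow> (\<forall>x. a \<le> g x \<and> g x \<le> b)
     \<longrightarrow> (\<exists>a' b'. (\<forall>x. a' \<le> K g x \<and> K g x \<le> b') \<and> b' - a' = (1 - c) * (b - a))"
    using K_contracts_oscillation by blast
  have "\<bar>(K ^^ n) g x\<bar> \<le> 2 * B * (1 - c) ^ n"
    if [measurable]: "g \<in> borel_measurable borel" and g: "\<And>x. \<bar>g x\<bar> \<le> B" "(\<integral>x. g x \<partial>\<pi>) = 0" for g B n x
  proof -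
    have "(K ^^ n) g \<in> borel_measurable borel \<and> (\<integral>x. (K ^^ n) g x \<partial>\<pi>) = 0 \<and>
        (\<exists>a b. (\<forall>x. a \<le> (K ^^ n) g x \<and> (K ^^ n) g x \<le> b) \<and> b - a = 2 * B * (1 - c) ^ n)"
    proof (induction n)
      case 0
      have "- B \<le> g x \<and> g x \<le> B" for x using g(1)[of x] by linarith
      then have "\<exists>a b. (\<forall>x. a \<le> g x \<and> g x \<le> b) \<and> b - a = 2 * B"
        by (intro exI[of _ "-B"] exI[of _ B]) simp
      then show ?case using that g by simp
    next
      case (Suc n)
      then obtain a b where meas: "(K ^^ n) g \<in> borel_measurable borel" and z: "(\<integral>x. (K ^^ n) g x \<partial>\<pi>) = 0"
        and ab: "\<And>x. a \<le> (K ^^ n) g x" "\<And>x. (K ^^ n) g x \<le> b" "b - a = 2 * B * (1 - c) ^ n" by blast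
      have "\<exists>a' b'. (\<forall>x. a' \<le> K ((K ^^ n) g) x \<and> K ((K ^^ n) g) x \<le> b') \<and> b' - a' = (1 - c) * (b - a)"
        using contr meas ab(1,2) by blast
      moreover have "(1 - c) * (b - a) = 2 * B * (1 - c) ^ Suc n" by (simp add: ab(3))
      moreover have "K ((K ^^ n) g) \<in> borel_measurable borel" using meas by measurable
      moreover have "(\<integral>x. K ((K ^^ n) g) x \<partial>\<pi>) = 0" using integral_K[OF meas ab(1,2)] z by simp
      ultimately show ?case by simp
    qed
    then obtain a b where meas: "(K ^^ n) g \<in> borel_measurable borel" and z: "(\<integral>x. (K ^^ n) g x \<partial>\<pi>) = 0"
      and ab: "\<And>x. a \<le> (K ^^ n) g x" "\<And>x. (K ^^ n) g x \<le> b" "b - a = 2 * B * (1 - c) ^ n" by blast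
    have "integrable \<pi> ((K ^^ n) g)"
    proof (rule \<pi>.integrable_const_bound[where B="max \<bar>a\<bar> \<bar>b\<bar>"])
      have "\<bar>(K ^^ n) g x\<bar> \<le> max \<bar>a\<bar> \<bar>b\<bar>" for x
        using ab(1)[of x] ab(2)[of x] by linarith
      then show "AE x in \<pi>. norm ((K ^^ n) g x) \<le> max \<bar>a\<bar> \<bar>b\<bar>" by simp
    qed (use meas in measurable)
    then have "a \<le> 0" "0 \<le> b"
      using ab \<pi>.integral_ge_const[of "(K ^^ n) g" a] \<pi>.integral_le_const[of "(K ^^ n) g" b] z by auto
    then show ?thesis using ab(1)[of x] ab(2)[of x] ab(3) by linarith
  qed
  with c show ?thesis by (intro exI[of _ "1 - c"]) auto
qed

end

section \<open>The coupled chains and the Markov property\<close>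

lemma chain_cong: "(\<And>s. 1 \<le> s \<Longrightarrow> e s = e' s) \<Longrightarrow> chain r x e t = chain r x e' t"
  by (induction t) auto

lemma coupled_chain_cong:
  "(\<And>s. 1 \<le> s \<Longrightarrow> e s = e' s) \<Longrightarrow> coupled_chain r x a e t = coupled_chain r x a e' t"
  by (induction r x a e t rule: coupled_chain.induct) auto

lemma flow_cong: "(\<And>s. 1 \<le> s \<Longrightarrow> e s = e' s) \<Longrightarrow> flow r e n x = flow r e' n x"
  by (induction n) (auto simp: step_map_def)

lemma flow_measurable:
  assumes [measurable]: "r \<in> borel_measurable borel" "g \<in> borel_measurable N"
    and e[measurable]: "\<And>s. 1 \<le> s \<Longrightarrow> (\<lambda>\<omega>. e \<omega> s) \<in> borel_measurable N"
  shows "(\<lambda>\<omega>. flow r (e \<omega>) n (g \<omega>)) \<in> borel_measurable N"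
proof (induction n)
  case (Suc n)
  note Suc[measurable]
  have [measurable]: "(\<lambda>\<omega>. e \<omega> (Suc n)) \<in> borel_measurable N" by (rule e) simp
  show ?case by (simp add: step_map_def)
qed simp

text \<open>The family \<open>W\<close> lists the sources of randomness: \<open>W 0\<close> is the starting point, \<open>W 1\<close> the resampled
  first innovation and \<open>W (t + 1)\<close> the innovation at time \<open>t \<ge> 1\<close>. The index of
  \<open>noise \<omega>\<close> is such that the pathwise functions, which read it at times \<open>s \<ge> 1\<close>, see the innovations.\<close>

locale coupled_chains = ar_model r r' f \<pi> + prob_space M
  for r r' f :: "real \<Rightarrow> real" and \<pi> :: "real measure" and M :: "'a measure" +
  fixes W :: "nat \<Rightarrow> 'a \<Rightarrow> real"
  assumes indep_W: "indep_vars (\<lambda>_. borel) W UNIV"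
    and law_W_0: "distr M borel (W 0) = \<pi>"
    and law_W_Suc: "\<And>n. distr M borel (W (Suc n)) = \<nu>"
begin

abbreviation noise :: "'a \<Rightarrow> nat \<Rightarrow> real" where "noise \<omega> s \<equiv> W (Suc s) \<omega>"

definition X :: "nat \<Rightarrow> 'a \<Rightarrow> real" where "X t \<omega> = chain r (W 0 \<omega>) (noise \<omega>) t"

definition Y :: "nat \<Rightarrow> 'a \<Rightarrow> real" where
  "Y t \<omega> = coupled_chain r (W 0 \<omega>) (W 1 \<omega>) (noise \<omega>) t"

lemma X_0: "X 0 \<omega> = W 0 \<omega>" and X_Suc: "X (Suc t) \<omega> = r (X t \<omega>) + W (Suc (Suc t)) \<omega>"
  by (simp_all add: X_def)

lemma Y_1: "Y (Suc 0) \<omega> = r (W 0 \<omega>) + W 1 \<omega>"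
  and Y_Suc: "t \<ge> 1 \<Longrightarrow> Y (Suc t) \<omega> = r (Y t \<omega>) + W (Suc (Suc t)) \<omega>"
  by (simp_all add: Y_def) (cases t, simp_all)

lemma W_measurable[measurable]: "W i \<in> borel_measurable M"
  using indep_W by (auto simp: indep_vars_def2)

lemma X_measurable[measurable]: "X t \<in> borel_measurable M"
proof (induction t)
  case (Suc t)
  note Suc[measurable]
  show ?case unfolding X_Suc by measurable
qed (simp add: X_0[abs_def])

lemma Y_measurable[measurable]: "Y t \<in> borel_measurable M"
proof (induction t)
  case (Suc t)
  note Suc[measurable]
  show ?case
  proof (cases "t = 0")
    case True
    have "Y (Suc 0) = (\<lambda>\<omega>. r (W 0 \<omega>) + W 1 \<omega>)" by (rule ext) (rule Y_1)
    then show ?thesis using True by simp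
  next
    case False
    then have "Y (Suc t) = (\<lambda>\<omega>. r (Y t \<omega>) + W (Suc (Suc t)) \<omega>)"
      by (intro ext Y_Suc) simp
    then show ?thesis by simp
  qed
qed (simp add: Y_def)

text \<open>Variables that depend on the first members of the family only. Being a measurable function of
  finitely many coordinates makes independence of the next member a statement about restrictions.\<close>

definition adapted :: "nat \<Rightarrow> 'b measure \<Rightarrow> ('a \<Rightarrow> 'b) \<Rightarrow> bool" where
  "adapted m N V \<longleftrightarrow> (\<exists>G \<in> measurable (PiM {..m} (\<lambda>_. borel)) N. \<forall>\<omega>. V \<omega> = G (\<lambda>i\<in>{..m}. W i \<omega>))"

lemma adapted_W: "i \<le> m \<Longrightarrow> adapted m borel (W i)"
  unfolding adapted_def by (intro bexI[of _ "\<lambda>w. w i"]) auto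

lemma adapted_compose:
  assumes V: "adapted m N V" and h: "h \<in> measurable N N'"
  shows "adapted m N' (\<lambda>\<omega>. h (V \<omega>))"
proof -
  obtain G where "G \<in> measurable (PiM {..m} (\<lambda>_. borel)) N" "\<And>\<omega>. V \<omega> = G (\<lambda>i\<in>{..m}. W i \<omega>)"
    using V unfolding adapted_def by blast
  then show ?thesis
    using h unfolding adapted_def by (intro bexI[of _ "\<lambda>w. h (G w)"]) auto
qed

lemma adapted_Pair:
  assumes "adapted m N V" and "adapted m N' V'"
  shows "adapted m (N \<Otimes>\<^sub>M N') (\<lambda>\<omega>. (V \<omega>, V' \<omega>))"
proof -
  obtain G where G: "G \<in> measurable (PiM {..m} (\<lambda>_. borel)) N" "\<And>\<omega>. V \<omega> = G (\<lambda>i\<in>{..m}. W i \<omega>)"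
    using assms(1) unfolding adapted_def by blast
  obtain G' where G': "G' \<in> measurable (PiM {..m} (\<lambda>_. borel)) N'" "\<And>\<omega>. V' \<omega> = G' (\<lambda>i\<in>{..m}. W i \<omega>)"
    using assms(2) unfolding adapted_def by blast
  from G G' show ?thesis
    unfolding adapted_def by (intro bexI[of _ "\<lambda>w. (G w, G' w)"]) auto
qed

lemma adapted_plus:
  assumes "adapted m borel V" and "adapted m borel V'"
  shows "adapted m borel (\<lambda>\<omega>. V \<omega> + V' \<omega> :: real)"
  using adapted_compose[OF adapted_Pair[OF assms], of "\<lambda>(x, y). x + y" borel] by simp

lemma adapted_X: "t \<le> m \<Longrightarrow> adapted (Suc m) borel (X t)"
proof (induction t)
  case 0
  then show ?case using adapted_W[of 0] by (simp add: X_0[abs_def])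
next
  case (Suc t)
  then show ?case
    unfolding X_Suc by (intro adapted_plus adapted_compose[where h=r] adapted_W) auto
qed

lemma adapted_Y: "t \<le> m \<Longrightarrow> adapted (Suc m) borel (Y t)"
proof (induction t)
  case 0
  then show ?case using adapted_W[of 0] by (simp add: Y_def)
next
  case (Suc t)
  show ?case
  proof (cases "t = 0")
    case True
    have "Y (Suc 0) = (\<lambda>\<omega>. r (W 0 \<omega>) + W 1 \<omega>)" by (rule ext) (rule Y_1)
    then show ?thesis
      using True Suc by (auto intro!: adapted_plus adapted_compose[where h=r] adapted_W)
  next
    case False
    then have "Y (Suc t) = (\<lambda>\<omega>. r (Y t \<omega>) + W (Suc (Suc t)) \<omega>)"
      by (intro ext Y_Suc) simp
    then show ?thesis
      using Suc by (auto intro!: adapted_plus adapted_compose[where h=r] adapted_W)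
  qed
qed

lemma adapted_measurable: "adapted m N V \<Longrightarrow> V \<in> measurable M N"
proof -
  assume "adapted m N V"
  then obtain G where [measurable]: "G \<in> measurable (PiM {..m} (\<lambda>_. borel)) N"
    and V: "\<And>\<omega>. V \<omega> = G (\<lambda>i\<in>{..m}. W i \<omega>)"
    unfolding adapted_def by blast
  show ?thesis unfolding V by measurable
qed

lemma joint_law_next:
  assumes "adapted m N V"
  shows "distr M (N \<Otimes>\<^sub>M borel) (\<lambda>\<omega>. (V \<omega>, W (Suc m) \<omega>)) = distr M N V \<Otimes>\<^sub>M \<nu>"
    and "distr M (borel \<Otimes>\<^sub>M N) (\<lambda>\<omega>. (W (Suc m) \<omega>, V \<omega>)) = \<nu> \<Otimes>\<^sub>M distr M N V"
proof -
  obtain G where [measurable]: "G \<in> measurable (PiM {..m} (\<lambda>_. borel)) N"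
    and V: "V = (\<lambda>\<omega>. G (\<lambda>i\<in>{..m}. W i \<omega>))"
    using assms unfolding adapted_def by blast
  have W: "W (Suc m) = (\<lambda>\<omega>. (\<lambda>w. w (Suc m)) (\<lambda>i\<in>{Suc m}. W i \<omega>))" by auto
  have 1: "indep_var (PiM {..m} (\<lambda>_. borel)) (\<lambda>\<omega>. \<lambda>i\<in>{..m}. W i \<omega>)
       (PiM {Suc m} (\<lambda>_. borel)) (\<lambda>\<omega>. \<lambda>i\<in>{Suc m}. W i \<omega>)"
    by (rule indep_var_restrict[OF indep_W]) auto
  have 2: "indep_var (PiM {Suc m} (\<lambda>_. borel)) (\<lambda>\<omega>. \<lambda>i\<in>{Suc m}. W i \<omega>)
       (PiM {..m} (\<lambda>_. borel)) (\<lambda>\<omega>. \<lambda>i\<in>{..m}. W i \<omega>)"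
    by (rule indep_var_restrict[OF indep_W]) auto
  show "distr M (N \<Otimes>\<^sub>M borel) (\<lambda>\<omega>. (V \<omega>, W (Suc m) \<omega>)) = distr M N V \<Otimes>\<^sub>M \<nu>"
    using indep_var_joint_law[OF 1, of G N "\<lambda>w. w (Suc m)" borel] law_W_Suc[of m] unfolding V by simp
  show "distr M (borel \<Otimes>\<^sub>M N) (\<lambda>\<omega>. (W (Suc m) \<omega>, V \<omega>)) = \<nu> \<Otimes>\<^sub>M distr M N V"
    using indep_var_joint_law[OF 2, of "\<lambda>w. w (Suc m)" borel G N] law_W_Suc[of m] unfolding V by simp
qed

text \<open>Fubini with the new innovation as the outer variable: a property of the past that holds almost
  surely for each fixed innovation survives a random one.\<close>

lemma AE_next:
  assumes V: "adapted m N V"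
    and P[measurable]: "{z \<in> space (borel \<Otimes>\<^sub>M N). P z} \<in> sets (borel \<Otimes>\<^sub>M N)"
    and AE: "\<And>e. AE \<omega> in M. P (e, V \<omega>)"
  shows "AE \<omega> in M. P (W (Suc m) \<omega>, V \<omega>)"
proof -
  note V' = adapted_measurable[OF V]
  note V'[measurable]
  interpret V: prob_space "distr M N V" by (rule prob_space_distr[OF V'])
  interpret VN: pair_prob_space \<nu> "distr M N V" ..
  have "AE v in distr M N V. P (e, v)" for e
    using AE[of e] P by (subst AE_distr_iff[OF V']) (auto simp: space_pair_measure)
  then have "AE z in \<nu> \<Otimes>\<^sub>M distr M N V. P z"
    using P by (intro VN.AE_pair_measure) (auto cong: sets_pair_measure_cong simp: space_pair_measure)
  then show ?thesis
    unfolding joint_law_next(2)[OF V, symmetric] using P by (subst (asm) AE_distr_iff) auto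
qed

text \<open>The Markov property: the next innovation is integrated out, given the past.\<close>

lemma expectation_next:
  fixes \<phi> :: "'b \<times> real \<Rightarrow> real"
  assumes V: "adapted m N V" and [measurable]: "\<phi> \<in> borel_measurable (N \<Otimes>\<^sub>M borel)"
    and b: "\<And>z. \<bar>\<phi> z\<bar> \<le> B"
  shows "expectation (\<lambda>\<omega>. \<phi> (V \<omega>, W (Suc m) \<omega>)) = expectation (\<lambda>\<omega>. \<integral>e. \<phi> (V \<omega>, e) \<partial>\<nu>)"
proof -
  note V' = adapted_measurable[OF V]
  note V'[measurable]
  interpret V: prob_space "distr M N V" by (rule prob_space_distr[OF V'])
  interpret VN: pair_prob_space "distr M N V" \<nu> ..
  have int: "integrable (distr M N V \<Otimes>\<^sub>M \<nu>) \<phi>"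
    using b by (intro VN.integrable_const_bound[where B=B]) auto
  have "expectation (\<lambda>\<omega>. \<phi> (V \<omega>, W (Suc m) \<omega>)) = (\<integral>z. \<phi> z \<partial>(distr M N V \<Otimes>\<^sub>M \<nu>))"
    unfolding joint_law_next(1)[OF V, symmetric] by (subst integral_distr) auto
  also have "\<dots> = (\<integral>v. \<integral>e. \<phi> (v, e) \<partial>\<nu> \<partial>distr M N V)"
    by (rule VN.integral_fst'[OF int, symmetric])
  also have "\<dots> = expectation (\<lambda>\<omega>. \<integral>e. \<phi> (V \<omega>, e) \<partial>\<nu>)"
    by (rule integral_distr) measurable
  finally show ?thesis .
qed

section \<open>A quadratic law of large numbers\<close>

text \<open>The Markov property, applied from the latest time backwards, turns each step into a factor of the
  transition operator.\<close>

lemma expectation_pair_lag: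
  assumes [measurable]: "h \<in> borel_measurable borel" and h: "\<And>x. \<bar>h x\<bar> \<le> A"
  shows "g \<in> borel_measurable borel \<Longrightarrow> (\<And>x. \<bar>g x\<bar> \<le> B) \<Longrightarrow>
    expectation (\<lambda>\<omega>. h (X s \<omega>) * g (X (s + n) \<omega>)) = expectation (\<lambda>\<omega>. h (X s \<omega>) * (K ^^ n) g (X s \<omega>))"
proof (induction n arbitrary: g)
  case (Suc n)
  note Suc.prems(1)[measurable]
  have A: "0 \<le> A" using h[of 0] by linarith
  have V: "adapted (Suc (s + n)) (borel \<Otimes>\<^sub>M borel) (\<lambda>\<omega>. (X s \<omega>, X (s + n) \<omega>))"
    by (intro adapted_Pair adapted_X) auto
  have "expectation (\<lambda>\<omega>. h (X s \<omega>) * g (X (s + Suc n) \<omega>))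
      = expectation (\<lambda>\<omega>. (\<lambda>z. h (fst (fst z)) * g (r (snd (fst z)) + snd z)) ((X s \<omega>, X (s + n) \<omega>), W (Suc (Suc (s + n))) \<omega>))"
    by (simp add: X_Suc)
  also have "\<dots> = expectation (\<lambda>\<omega>. \<integral>e. (\<lambda>z. h (fst (fst z)) * g (r (snd (fst z)) + snd z)) ((X s \<omega>, X (s + n) \<omega>), e) \<partial>\<nu>)"
  proof (rule expectation_next[OF V, where B="A * B"])
    show "\<bar>h (fst (fst z)) * g (r (snd (fst z)) + snd z)\<bar> \<le> A * B" for z
      using h Suc.prems(2) A by (auto simp: abs_mult intro!: mult_mono)
  qed measurable
  also have "\<dots> = expectation (\<lambda>\<omega>. h (X s \<omega>) * K g (X (s + n) \<omega>))"
    by (simp add: K_def)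
  also have "\<dots> = expectation (\<lambda>\<omega>. h (X s \<omega>) * (K ^^ n) (K g) (X s \<omega>))"
  proof (rule Suc.IH)
    have B: "- B \<le> g x" "g x \<le> B" for x using Suc.prems(2)[of x] by linarith+
    have int: "integrable \<nu> (\<lambda>e. g (r x + e))" for x
      by (rule integrable_innovation[where a="-B" and b=B]) (use B in auto)
    have "- B \<le> K g x" for x
      unfolding K_def by (rule \<nu>.integral_ge_const[OF int]) (use B in auto)
    moreover have "K g x \<le> B" for x
      unfolding K_def by (rule \<nu>.integral_le_const[OF int]) (use B in auto)
    ultimately show "\<bar>K g x\<bar> \<le> B" for x by (simp add: abs_le_iff minus_le_iff)
  qed measurable
  finally show ?case by (simp only: funpow_Suc_right o_apply)
qed simp

text \<open>Correlations decay geometrically, so adding one more term to the sum raises its second moment by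
  a bounded amount: the square of the term, plus twice a geometric series of correlations.\<close>

lemma X_second_moment:
  assumes [measurable]: "h \<in> borel_measurable borel" and h: "\<And>x. \<bar>h x\<bar> \<le> B" and mean: "(\<integral>x. h x \<partial>\<pi>) = 0"
  shows "\<exists>C\<ge>0. \<forall>n. expectation (\<lambda>\<omega>. (\<Sum>t<n. h (X t \<omega>))\<^sup>2) \<le> C * real n"
proof -
  obtain \<rho> where \<rho>: "0 \<le> \<rho>" "\<rho> < 1" and decay: "\<And>n x. \<bar>(K ^^ n) h x\<bar> \<le> 2 * B * \<rho> ^ n"
    using K_geometric_decay h mean assms(1) by blast
  have B: "0 \<le> B" using h[of 0] by linarith
  have hint: "integrable M (\<lambda>\<omega>. h (X s \<omega>) * h (X t \<omega>))" for s t
    using h B by (intro integrable_const_bound[where B="B * B"]) (auto simp: abs_mult intro!: mult_mono)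
  have lag: "expectation (\<lambda>\<omega>. h (X s \<omega>) * h (X (s + n) \<omega>)) \<le> 2 * B\<^sup>2 * \<rho> ^ n" for s n
  proof -
    have Kn[measurable]: "(K ^^ n) h \<in> borel_measurable borel" by (induction n) simp_all
    have bd: "\<bar>h x * (K ^^ n) h x\<bar> \<le> B * (2 * B * \<rho> ^ n)" for x
      unfolding abs_mult using h decay B by (intro mult_mono) auto
    have "expectation (\<lambda>\<omega>. h (X s \<omega>) * h (X (s + n) \<omega>)) = expectation (\<lambda>\<omega>. h (X s \<omega>) * (K ^^ n) h (X s \<omega>))"
      by (rule expectation_pair_lag[OF assms(1) h assms(1) h])
    also have "\<dots> \<le> B * (2 * B * \<rho> ^ n)"
    proof (rule integral_le_const)
      show "integrable M (\<lambda>\<omega>. h (X s \<omega>) * (K ^^ n) h (X s \<omega>))"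
        using bd by (intro integrable_const_bound[where B="B * (2 * B * \<rho> ^ n)"]) auto
      show "AE \<omega> in M. h (X s \<omega>) * (K ^^ n) h (X s \<omega>) \<le> B * (2 * B * \<rho> ^ n)"
        using bd order_trans[OF abs_ge_self] by auto
    qed
    finally show ?thesis by (simp add: power2_eq_square mult_ac)
  qed
  define C where "C = 4 * B\<^sup>2 / (1 - \<rho>) + B\<^sup>2"
  have C: "0 \<le> C" using \<rho> by (simp add: C_def)
  have "expectation (\<lambda>\<omega>. (\<Sum>t<n. h (X t \<omega>))\<^sup>2) \<le> C * real n" for n
  proof (induction n)
    case (Suc n)
    have int1: "integrable M (\<lambda>\<omega>. (\<Sum>t<n. h (X t \<omega>))\<^sup>2)"
      unfolding power2_eq_square sum_product by (intro Bochner_Integration.integrable_sum hint)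
    have int2: "integrable M (\<lambda>\<omega>. \<Sum>t<n. h (X t \<omega>) * h (X n \<omega>))"
      by (intro Bochner_Integration.integrable_sum hint)
    have "expectation (\<lambda>\<omega>. (\<Sum>t<Suc n. h (X t \<omega>))\<^sup>2)
        = expectation (\<lambda>\<omega>. (\<Sum>t<n. h (X t \<omega>))\<^sup>2 + 2 * (\<Sum>t<n. h (X t \<omega>) * h (X n \<omega>)) + h (X n \<omega>) * h (X n \<omega>))"
      by (intro Bochner_Integration.integral_cong)
        (simp_all add: power2_eq_square sum_distrib_right[symmetric] algebra_simps)
    also have "\<dots> = expectation (\<lambda>\<omega>. (\<Sum>t<n. h (X t \<omega>))\<^sup>2)
        + 2 * (\<Sum>t<n. expectation (\<lambda>\<omega>. h (X t \<omega>) * h (X n \<omega>))) + expectation (\<lambda>\<omega>. h (X n \<omega>) * h (X n \<omega>))"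
      using int1 int2 hint by simp
    also have "(\<Sum>t<n. expectation (\<lambda>\<omega>. h (X t \<omega>) * h (X n \<omega>))) \<le> (\<Sum>t<n. 2 * B\<^sup>2 * \<rho> ^ (n - t))"
    proof (rule sum_mono)
      fix t assume "t \<in> {..<n}"
      then show "expectation (\<lambda>\<omega>. h (X t \<omega>) * h (X n \<omega>)) \<le> 2 * B\<^sup>2 * \<rho> ^ (n - t)"
        using lag[of t "n - t"] by simp
    qed
    also have "(\<Sum>t<n. 2 * B\<^sup>2 * \<rho> ^ (n - t)) = 2 * B\<^sup>2 * (\<Sum>t<n. \<rho> ^ Suc t)"
      unfolding sum_distrib_left[symmetric]
      by (subst sum.nat_diff_reindex[symmetric]) (auto intro!: sum.cong arg_cong[where f="(*) (2 * B\<^sup>2)"] simp: Suc_diff_Suc)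
    also have "\<dots> \<le> 2 * B\<^sup>2 * (1 / (1 - \<rho>))"
    proof (rule mult_left_mono)
      have "(\<Sum>t<n. \<rho> ^ Suc t) \<le> (\<Sum>t<n. \<rho> ^ t)"
        using \<rho> by (intro sum_mono) (simp add: mult_left_le_one_le)
      also have "\<dots> \<le> (\<Sum>t. \<rho> ^ t)"
        using \<rho> by (intro sum_le_suminf summable_geometric) auto
      also have "\<dots> = 1 / (1 - \<rho>)" using \<rho> by (intro suminf_geometric) simp
      finally show "(\<Sum>t<n. \<rho> ^ Suc t) \<le> 1 / (1 - \<rho>)" .
    qed simp
    also have "expectation (\<lambda>\<omega>. h (X n \<omega>) * h (X n \<omega>)) \<le> B * B"
    proof (rule integral_le_const[OF hint])
      have "h x * h x \<le> B * B" for x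
        using mult_mono[OF h[of x] h[of x] B] by (simp add: abs_mult[symmetric])
      then show "AE \<omega> in M. h (X n \<omega>) * h (X n \<omega>) \<le> B * B" by simp
    qed
    finally have "expectation (\<lambda>\<omega>. (\<Sum>t<Suc n. h (X t \<omega>))\<^sup>2)
        \<le> expectation (\<lambda>\<omega>. (\<Sum>t<n. h (X t \<omega>))\<^sup>2) + C"
      by (simp add: C_def power2_eq_square)
    also have "\<dots> \<le> C * real n + C" using Suc.IH by simp
    finally show ?case by (simp add: algebra_simps)
  qed simp
  with C show ?thesis by blast
qed

text \<open>Chebyshev's inequality for the centred function.\<close>

lemma X_law_of_large_numbers:
  fixes \<kappa> :: real
  assumes [measurable]: "g \<in> borel_measurable borel" and g: "\<And>x. \<bar>g x\<bar> \<le> B" and \<kappa>: "\<kappa> > 0"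
  shows "\<exists>C. \<forall>n>0. prob {\<omega>\<in>space M. \<bar>(\<Sum>t<n. g (X t \<omega>)) - real n * (\<integral>x. g x \<partial>\<pi>)\<bar> \<ge> real n * \<kappa>} \<le> C / real n"
proof -
  define m where "m = (\<integral>x. g x \<partial>\<pi>)"
  define h where "h x = g x - m" for x
  have [measurable]: "h \<in> borel_measurable borel" unfolding h_def[abs_def] by measurable
  have h: "\<bar>h x\<bar> \<le> B + \<bar>m\<bar>" for x using g[of x] unfolding h_def by linarith
  have "integrable \<pi> g" using g by (intro \<pi>.integrable_const_bound[where B=B]) auto
  then have "(\<integral>x. h x \<partial>\<pi>) = 0"
    using \<pi>.prob_space by (simp add: h_def[abs_def] m_def)
  then obtain C where C: "\<And>n. expectation (\<lambda>\<omega>. (\<Sum>t<n. h (X t \<omega>))\<^sup>2) \<le> C * real n"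
    using X_second_moment[of h "B + \<bar>m\<bar>"] h by auto
  have "prob {\<omega>\<in>space M. \<bar>(\<Sum>t<n. g (X t \<omega>)) - real n * m\<bar> \<ge> real n * \<kappa>} \<le> (C / \<kappa>\<^sup>2) / real n"
    if n: "n > 0" for n
  proof -
    have eq: "(\<Sum>t<n. g (X t \<omega>)) - real n * m = (\<Sum>t<n. h (X t \<omega>))" for \<omega>
      by (simp add: h_def sum_subtractf)
    have "\<bar>\<Sum>t<n. h (X t \<omega>)\<bar> \<le> n * (B + \<bar>m\<bar>)" for \<omega>
      using h sum_bounded_above[of "{..<n}" "\<lambda>t. \<bar>h (X t \<omega>)\<bar>" "B + \<bar>m\<bar>"]
      by (intro order_trans[OF sum_abs]) auto
    from power_mono[OF this abs_ge_zero, where n=2]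
    have "integrable M (\<lambda>\<omega>. (\<Sum>t<n. h (X t \<omega>))\<^sup>2)"
      by (intro integrable_const_bound[where B="(n * (B + \<bar>m\<bar>))\<^sup>2"]) auto
    then have "prob {\<omega>\<in>space M. \<bar>\<Sum>t<n. h (X t \<omega>)\<bar> \<ge> real n * \<kappa>}
        \<le> expectation (\<lambda>\<omega>. (\<Sum>t<n. h (X t \<omega>))\<^sup>2) / (real n * \<kappa>)\<^sup>2"
      using n \<kappa> by (intro second_moment_method) auto
    also have "\<dots> \<le> C * real n / (real n * \<kappa>)\<^sup>2" by (intro divide_right_mono C) simp
    also have "\<dots> = (C / \<kappa>\<^sup>2) / n" using n by (simp add: power2_eq_square)
    finally show ?thesis unfolding eq .
  qed
  then show ?thesis unfolding m_def by blast
qed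

section \<open>Null sets of the pair of trajectories\<close>

text \<open>The index \<open>2\<close> comes before \<open>1\<close> so that the innovations appear in the order of \<open>(X 1, Y 1)\<close>.\<close>

lemma joint_law_first_step:
  "distr M (borel \<Otimes>\<^sub>M (borel \<Otimes>\<^sub>M borel)) (\<lambda>\<omega>. (W 0 \<omega>, (W 2 \<omega>, W 1 \<omega>))) = \<pi> \<Otimes>\<^sub>M (\<nu> \<Otimes>\<^sub>M \<nu>)"
proof -
  have ind: "indep_var (PiM {0} (\<lambda>_. borel)) (\<lambda>\<omega>. \<lambda>i\<in>{0}. W i \<omega>)
       (PiM {1,2} (\<lambda>_. borel)) (\<lambda>\<omega>. \<lambda>i\<in>{1,2}. W i \<omega>)"
    by (rule indep_var_restrict[OF indep_W]) auto
  have "distr M (borel \<Otimes>\<^sub>M (borel \<Otimes>\<^sub>M borel)) (\<lambda>\<omega>. (W 0 \<omega>, (W 2 \<omega>, W 1 \<omega>)))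
      = distr M borel (W 0) \<Otimes>\<^sub>M distr M (borel \<Otimes>\<^sub>M borel) (\<lambda>\<omega>. (W 2 \<omega>, W 1 \<omega>))"
    using indep_var_joint_law[OF ind, of "\<lambda>w. w 0" borel "\<lambda>w. (w 2, w 1)" "borel \<Otimes>\<^sub>M borel"] by simp
  also have "distr M (borel \<Otimes>\<^sub>M borel) (\<lambda>\<omega>. (W 2 \<omega>, W 1 \<omega>)) = \<nu> \<Otimes>\<^sub>M \<nu>"
    using joint_law_next(2)[OF adapted_W[of 1 1]] law_W_Suc[of 0] by (simp add: numeral_2_eq_2)
  finally show ?thesis by (simp add: law_W_0)
qed

lemma AE_first_step_iff:
  assumes P[measurable]: "Measurable.pred (borel \<Otimes>\<^sub>M borel) P"
  shows "(AE \<omega> in M. P (X 1 \<omega>, Y 1 \<omega>)) \<longleftrightarrow>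
    (AE x in \<pi>. AE a in lborel. AE b in lborel. P (r x + a, r x + b))"
proof -
  interpret \<nu>\<nu>: pair_prob_space \<nu> \<nu> ..
  interpret \<pi>\<nu>\<nu>: pair_prob_space \<pi> "\<nu> \<Otimes>\<^sub>M \<nu>" ..
  have XY: "X 1 \<omega> = r (W 0 \<omega>) + W 2 \<omega>" "Y 1 \<omega> = r (W 0 \<omega>) + W 1 \<omega>" for \<omega>
    using X_Suc[of 0] Y_1 by (simp_all add: X_0 numeral_2_eq_2)
  let ?Q = "\<lambda>z. P (r (fst z) + fst (snd z), r (fst z) + snd (snd z))"
  have Q: "Measurable.pred (\<pi> \<Otimes>\<^sub>M (\<nu> \<Otimes>\<^sub>M \<nu>)) ?Q" by measurable
  have Q': "Measurable.pred (\<nu> \<Otimes>\<^sub>M \<nu>) (\<lambda>p. P (r x + fst p, r x + snd p))" for x by measurable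
  have "(AE \<omega> in M. P (X 1 \<omega>, Y 1 \<omega>)) \<longleftrightarrow> (AE \<omega> in M. ?Q (W 0 \<omega>, (W 2 \<omega>, W 1 \<omega>)))"
    by (simp only: XY fst_conv snd_conv)
  also have "\<dots> \<longleftrightarrow> (AE z in distr M (borel \<Otimes>\<^sub>M (borel \<Otimes>\<^sub>M borel)) (\<lambda>\<omega>. (W 0 \<omega>, (W 2 \<omega>, W 1 \<omega>))). ?Q z)"
    by (subst AE_distr_iff) auto
  also have "\<dots> \<longleftrightarrow> (AE z in \<pi> \<Otimes>\<^sub>M (\<nu> \<Otimes>\<^sub>M \<nu>). ?Q z)"
    unfolding joint_law_first_step ..
  also have "\<dots> \<longleftrightarrow> (AE x in \<pi>. AE p in \<nu> \<Otimes>\<^sub>M \<nu>. P (r x + fst p, r x + snd p))"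
    using Q by (subst \<pi>\<nu>\<nu>.AE_pair_iff[symmetric]) (simp_all add: pred_def)
  also have "\<dots> \<longleftrightarrow> (AE x in \<pi>. AE a in \<nu>. AE b in \<nu>. P (r x + a, r x + b))"
    using Q' by (subst \<nu>\<nu>.AE_pair_iff[symmetric]) (simp_all add: pred_def)
  finally show ?thesis unfolding AE_innovation_iff .
qed

text \<open>Given the starting point, \<open>(X 1, Y 1)\<close> is a translate of two independent innovations with positive
  density. So its law has the same null sets as Lebesgue measure; the backward direction starts the
  induction on absolute continuity, the forward one serves the claim on almost all starting points.\<close>

lemma AE_step_one_pair_iff:
  assumes P[measurable]: "Measurable.pred (borel \<Otimes>\<^sub>M borel) P"
  shows "(AE \<omega> in M. P (X 1 \<omega>, Y 1 \<omega>)) \<longleftrightarrow> (AE x in lborel. AE y in lborel. P (x, y))"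
proof -
  have "(AE a in lborel. AE b in lborel. P (c + a, c + b)) \<longleftrightarrow> (AE x in lborel. AE y in lborel. P (x, y))"
    for c :: real
    by (subst AE_lborel_shift_iff, subst AE_lborel_shift_iff[of "\<lambda>x. AE y in lborel. P (x, y)"]) simp
  then show ?thesis unfolding AE_first_step_iff[OF P] by simp
qed

text \<open>Absolute continuity of the law of \<open>(X t, Y t)\<close> for \<open>t \<ge> 1\<close>, phrased without null sets. For a fixed
  innovation \<open>e\<close> the step \<open>(x, y) \<mapsto> (r x + e, r y + e)\<close> is nonsingular in each coordinate, so the property is
  pulled back one coordinate at a time; the random innovation is then inserted by Fubini.\<close>

lemma AE_pair_if_AE_lborel:
  assumes crit: "AE x in lborel. r' x \<noteq> 0"
  shows "Measurable.pred (borel \<Otimes>\<^sub>M borel) P \<Longrightarrow> AE x in lborel. AE y in lborel. P (x, y) \<Longrightarrow>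
    AE \<omega> in M. P (X (Suc t) \<omega>, Y (Suc t) \<omega>)"
proof (induction t arbitrary: P)
  case 0
  then show ?case using AE_step_one_pair_iff[of P] by simp
next
  case (Suc t)
  note Suc.prems(1)[measurable]
  have pull: "AE x in lborel. Q (r x + e)" if "AE x in lborel. Q x" for Q and e :: real
    by (rule AE_lborel_compose[OF _ continuous_r' crit that]) (auto intro!: derivative_eq_intros r_deriv)
  have "AE \<omega> in M. P (r (X (Suc t) \<omega>) + e, r (Y (Suc t) \<omega>) + e)" for e
  proof -
    have "AE x in lborel. AE y in lborel. P (x, r y + e)"
      using Suc.prems(2) by eventually_elim (rule pull)
    then have "AE x in lborel. AE y in lborel. P (r x + e, r y + e)"
      by (rule pull)
    then show ?thesis using Suc.IH[of "\<lambda>z. P (r (fst z) + e, r (snd z) + e)"] by simp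
  qed
  then have "AE \<omega> in M. (\<lambda>z. P (r (fst (snd z)) + fst z, r (snd (snd z)) + fst z))
      (W (Suc (Suc (Suc t))) \<omega>, (X (Suc t) \<omega>, Y (Suc t) \<omega>))"
    by (intro AE_next[where N="borel \<Otimes>\<^sub>M borel"] adapted_Pair adapted_X adapted_Y) auto
  then show ?case by (simp add: X_Suc Y_Suc)
qed

text \<open>The diagonal is a null set of the plane.\<close>

lemma AE_never_meet:
  assumes crit: "AE x in lborel. r' x \<noteq> 0"
  shows "AE \<omega> in M. \<forall>t\<ge>1. X t \<omega> \<noteq> Y t \<omega>"
proof -
  have "AE x in lborel. AE y in lborel. x \<noteq> (y :: real)"
    using AE_lborel_singleton by (auto simp: eq_commute)
  then have "AE \<omega> in M. X (Suc t) \<omega> \<noteq> Y (Suc t) \<omega>" for t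
    using AE_pair_if_AE_lborel[OF crit, of "\<lambda>z. fst z \<noteq> snd z" t] by simp
  then have "AE \<omega> in M. \<forall>t. X (Suc t) \<omega> \<noteq> Y (Suc t) \<omega>"
    by (simp add: AE_all_countable)
  then show ?thesis
    by eventually_elim (metis Suc_le_D One_nat_def)
qed

end

section \<open>From the coupled pair to almost all starting points\<close>

text \<open>Countable quantifiers make the event of convergence measurable.\<close>

lemma tendsto_zero_iff_countable:
  fixes a :: "nat \<Rightarrow> real"
  shows "a \<longlonglongrightarrow> 0 \<longleftrightarrow> (\<forall>k::nat. \<exists>m. \<forall>n\<ge>m. \<bar>a n\<bar> < inverse (real (Suc k)))"
proof
  assume "a \<longlonglongrightarrow> 0"
  then show "\<forall>k::nat. \<exists>m. \<forall>n\<ge>m. \<bar>a n\<bar> < inverse (real (Suc k))"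
    unfolding LIMSEQ_iff by auto
next
  assume *: "\<forall>k::nat. \<exists>m. \<forall>n\<ge>m. \<bar>a n\<bar> < inverse (real (Suc k))"
  show "a \<longlonglongrightarrow> 0"
    unfolding LIMSEQ_iff
  proof (intro allI impI)
    fix d :: real assume "0 < d"
    then obtain k where "inverse (real (Suc k)) < d" using reals_Archimedean by blast
    moreover from * obtain m where "\<forall>n\<ge>m. \<bar>a n\<bar> < inverse (real (Suc k))" by blast
    ultimately show "\<exists>m. \<forall>n\<ge>m. norm (a n - 0) < d" by (intro exI[of _ m]) force
  qed
qed

lemma pred_tendsto_zero[measurable (raw)]:
  fixes a :: "nat \<Rightarrow> 'b \<Rightarrow> real"
  assumes [measurable]: "\<And>n. a n \<in> borel_measurable N"
  shows "Measurable.pred N (\<lambda>\<omega>. (\<lambda>n. a n \<omega>) \<longlonglongrightarrow> 0)"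
  unfolding tendsto_zero_iff_countable by measurable

context coupled_chains
begin

lemma law_noise_window:
  "distr M (PiM {1..} (\<lambda>_. borel)) (\<lambda>\<omega>. \<lambda>s\<in>{1..}. W (s + k) \<omega>) = PiM {1..} (\<lambda>_. \<nu>)"
proof -
  have "indep_vars (\<lambda>_. borel) (\<lambda>s. W (s + k)) {1..}"
    by (rule indep_vars_reindex_inj[where \<phi>="\<lambda>s. s + k" and N="\<lambda>_. borel" and Z=W])
      (auto intro: indep_vars_subset[OF indep_W] simp: inj_on_def)
  then have "distr M (PiM {1..} (\<lambda>_. borel)) (\<lambda>\<omega>. \<lambda>s\<in>{1..}. W (s + k) \<omega>)
      = PiM {1..} (\<lambda>s. distr M borel (W (s + k)))"
    by (subst (asm) indep_vars_iff_distr_eq_PiM') auto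
  also have "\<dots> = PiM {1..} (\<lambda>_. \<nu>)"
  proof (rule PiM_cong)
    fix s :: nat assume "s \<in> {1..}"
    then obtain j where "s + k = Suc j" by (cases "s + k") auto
    then show "distr M borel (W (s + k)) = \<nu>" by (simp add: law_W_Suc)
  qed simp
  finally show ?thesis .
qed

lemma X_eq_flow: "X (Suc n) \<omega> = flow r (\<lambda>s. W (s + 2) \<omega>) n (X 1 \<omega>)"
  by (induction n) (simp_all add: X_Suc step_map_def)

lemma Y_eq_flow: "Y (Suc n) \<omega> = flow r (\<lambda>s. W (s + 2) \<omega>) n (Y 1 \<omega>)"
  by (induction n) (simp_all add: Y_Suc step_map_def)

text \<open>The pair \<open>(X 1, Y 1)\<close> uses the members \<open>0, 1, 2\<close> of the family and the later flow the members
  from \<open>3\<close> on, so their joint law is a product. The later innovations are then replaced by those from time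
  1 on, as both windows have the same law.\<close>

lemma AE_flow_if_AE_coupled:
  assumes AE: "AE \<omega> in M. \<not> (\<lambda>n. X n \<omega> - Y n \<omega>) \<longlonglongrightarrow> 0"
  shows "AE z in lborel. AE \<omega> in M. \<not> (\<lambda>n. \<bar>flow r (noise \<omega>) n (fst z) - flow r (noise \<omega>) n (snd z)\<bar>) \<longlonglongrightarrow> 0"
proof -
  let ?S = "PiM {1..} (\<lambda>_. borel) :: (nat \<Rightarrow> real) measure"
  define E where "E = (\<lambda>(z, w). (\<lambda>n. \<bar>flow r w n (fst z) - flow r w n (snd z)\<bar>) \<longlonglongrightarrow> 0)"
  have E[measurable]: "Measurable.pred ((borel \<Otimes>\<^sub>M borel) \<Otimes>\<^sub>M ?S) E"
    unfolding E_def case_prod_beta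
    by (intro pred_tendsto_zero borel_measurable_abs borel_measurable_diff flow_measurable) measurable
  let ?w = "\<lambda>k \<omega>. \<lambda>s\<in>{1..}. W (s + k) \<omega>"
  have ind: "indep_var (PiM {..2} (\<lambda>_. borel)) (\<lambda>\<omega>. \<lambda>i\<in>{..2}. W i \<omega>)
       (PiM {3..} (\<lambda>_. borel)) (\<lambda>\<omega>. \<lambda>i\<in>{3..}. W i \<omega>)"
    by (rule indep_var_restrict[OF indep_W]) auto
  have "adapted 2 (borel \<Otimes>\<^sub>M borel) (\<lambda>\<omega>. (X 1 \<omega>, Y 1 \<omega>))"
    using adapted_Pair[OF adapted_X[of 1 1] adapted_Y[of 1 1]] by (simp add: numeral_2_eq_2)
  then obtain G where G[measurable]: "G \<in> measurable (PiM {..2} (\<lambda>_. borel)) (borel \<Otimes>\<^sub>M borel)"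
    and XY: "\<And>\<omega>. (X 1 \<omega>, Y 1 \<omega>) = G (\<lambda>i\<in>{..2}. W i \<omega>)"
    unfolding adapted_def by blast
  have H: "?w 2 \<omega> = (\<lambda>w. \<lambda>s\<in>{1..}. w (s + 2)) (\<lambda>i\<in>{3..}. W i \<omega>)" for \<omega> by auto
  let ?D = "distr M (borel \<Otimes>\<^sub>M borel) (\<lambda>\<omega>. (X 1 \<omega>, Y 1 \<omega>))"
  have law: "distr M ((borel \<Otimes>\<^sub>M borel) \<Otimes>\<^sub>M ?S) (\<lambda>\<omega>. ((X 1 \<omega>, Y 1 \<omega>), ?w 2 \<omega>)) = ?D \<Otimes>\<^sub>M PiM {1..} (\<lambda>_. \<nu>)"
    unfolding law_noise_window[of 2, symmetric] XY H
    by (rule indep_var_joint_law[OF ind]) measurable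
  interpret D: prob_space ?D by (rule prob_space_distr) measurable
  interpret S: prob_space "PiM {1..} (\<lambda>_. \<nu>)" by (rule prob_space_PiM) (rule \<nu>.prob_space_axioms)
  interpret DS: pair_prob_space ?D "PiM {1..} (\<lambda>_. \<nu>)" ..
  have "AE \<omega> in M. \<not> E ((X 1 \<omega>, Y 1 \<omega>), ?w 2 \<omega>)"
    using AE
  proof eventually_elim
    fix \<omega> assume D: "\<not> (\<lambda>n. X n \<omega> - Y n \<omega>) \<longlonglongrightarrow> 0"
    have eq: "X (Suc n) \<omega> = flow r (?w 2 \<omega>) n (X 1 \<omega>)" "Y (Suc n) \<omega> = flow r (?w 2 \<omega>) n (Y 1 \<omega>)" for n
      unfolding X_eq_flow Y_eq_flow by (rule flow_cong; simp)+
    show "\<not> E ((X 1 \<omega>, Y 1 \<omega>), ?w 2 \<omega>)"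
      unfolding E_def prod.case fst_conv snd_conv eq[symmetric]
      using D LIMSEQ_imp_Suc[of "\<lambda>n. X n \<omega> - Y n \<omega>" 0] by (auto simp: tendsto_rabs_zero_iff)
  qed
  then have "AE p in distr M ((borel \<Otimes>\<^sub>M borel) \<Otimes>\<^sub>M ?S) (\<lambda>\<omega>. ((X 1 \<omega>, Y 1 \<omega>), ?w 2 \<omega>)). \<not> E p"
    by (subst AE_distr_iff) measurable
  then have "AE z in ?D. AE w in PiM {1..} (\<lambda>_. \<nu>). \<not> E (z, w)"
    unfolding law by (rule DS.AE_pair)
  then have "AE z in ?D. AE \<omega> in M. \<not> E (z, ?w 1 \<omega>)"
  proof eventually_elim
    fix z assume "AE w in PiM {1..} (\<lambda>_. \<nu>). \<not> E (z, w)"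
    have [measurable]: "Measurable.pred ?S (\<lambda>w. E (z, w))"
      by (rule measurable_compose[OF measurable_Pair1' E]) (simp add: space_pair_measure)
    from \<open>AE w in PiM {1..} (\<lambda>_. \<nu>). \<not> E (z, w)\<close> show "AE \<omega> in M. \<not> E (z, ?w 1 \<omega>)"
      unfolding law_noise_window[of 1, symmetric] by (subst (asm) AE_distr_iff) (auto simp del: One_nat_def)
  qed
  \<comment> \<open>The exceptional set need not be measurable; a null superset \<open>N\<close> is carried from the law of \<open>(X 1, Y 1)\<close> to Lebesgue measure.\<close>
  then obtain N where N: "{z \<in> space ?D. \<not> (AE \<omega> in M. \<not> E (z, ?w 1 \<omega>))} \<subseteq> N" "emeasure ?D N = 0" "N \<in> sets ?D"
    by (rule AE_E)
  from N(3) have [measurable]: "N \<in> sets (borel \<Otimes>\<^sub>M borel)" by simp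
  have "AE z in ?D. z \<notin> N" using N by (intro AE_not_in) (auto simp: null_sets_def)
  then have "AE \<omega> in M. (X 1 \<omega>, Y 1 \<omega>) \<notin> N" by (subst (asm) AE_distr_iff) auto
  then have "AE x in lborel. AE y in lborel. (x, y) \<notin> N"
    by (subst (asm) AE_step_one_pair_iff) auto
  moreover have "space (borel \<Otimes>\<^sub>M borel) - N \<in> sets (borel \<Otimes>\<^sub>M borel)" by measurable
  ultimately have "AE z in lborel \<Otimes>\<^sub>M lborel. z \<notin> N"
    by (intro lborel_pair.AE_pair_measure) (simp_all add: space_pair_measure set_diff_eq)
  then have "AE z in lborel. z \<notin> N" by (simp only: lborel_prod)
  then show ?thesis
  proof eventually_elim
    fix z assume "z \<notin> N"
    with N(1) have "AE \<omega> in M. \<not> E (z, ?w 1 \<omega>)" by (auto simp: space_pair_measure)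
    then show "AE \<omega> in M. \<not> (\<lambda>n. \<bar>flow r (noise \<omega>) n (fst z) - flow r (noise \<omega>) n (snd z)\<bar>) \<longlonglongrightarrow> 0"
    proof eventually_elim
      fix \<omega> assume "\<not> E (z, ?w 1 \<omega>)"
      moreover have "flow r (?w 1 \<omega>) n x = flow r (noise \<omega>) n x" for n x
        by (rule flow_cong) simp
      ultimately show "\<not> (\<lambda>n. \<bar>flow r (noise \<omega>) n (fst z) - flow r (noise \<omega>) n (snd z)\<bar>) \<longlonglongrightarrow> 0"
        by (simp add: E_def)
    qed
  qed
qed

end

section \<open>Expansion along nearby trajectories\<close>

lemma log_minus_measurable[measurable]: "log_minus \<in> borel_measurable borel"
  unfolding log_minus_def[abs_def] by measurable

lemma log_minus_pos: "q > 0 \<Longrightarrow> log_minus q = ennreal (max (- ln q) 0)"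
  by (simp add: log_minus_def)

context ar_model
begin

definition trunc_log_deriv :: "real \<Rightarrow> real \<Rightarrow> real" where
  "trunc_log_deriv \<eta> x = (if \<bar>r' x\<bar> > \<eta> then ln \<bar>r' x\<bar> else 0)"

text \<open>The integrand of the uniform integrability hypothesis, as a function of the two positions.\<close>

definition critical_loss :: "real \<Rightarrow> real \<Rightarrow> real \<Rightarrow> real \<Rightarrow> ennreal" where
  "critical_loss \<eta> \<delta> x y = (if \<bar>r' x\<bar> \<le> \<eta> \<and> \<bar>x - y\<bar> \<le> \<delta> then log_minus (diff_quot r x y) else 0)"

lemma trunc_log_deriv_measurable[measurable]: "trunc_log_deriv \<eta> \<in> borel_measurable borel"
  unfolding trunc_log_deriv_def[abs_def] by measurable

lemma trunc_log_deriv_bounded: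
  assumes "\<eta> > 0"
  shows "\<exists>B. \<forall>x. \<bar>trunc_log_deriv \<eta> x\<bar> \<le> B"
proof -
  obtain R where R: "\<And>x. \<bar>r' x\<bar> \<le> R" using r'_bounded by (auto simp: bounded_iff)
  have "\<bar>trunc_log_deriv \<eta> x\<bar> \<le> \<bar>ln \<eta>\<bar> + \<bar>ln R\<bar>" for x
  proof (cases "\<bar>r' x\<bar> > \<eta>")
    case True
    with assms R[of x] have "ln \<eta> \<le> ln \<bar>r' x\<bar>" "ln \<bar>r' x\<bar> \<le> ln R" by auto
    with True show ?thesis unfolding trunc_log_deriv_def by auto
  qed (simp add: trunc_log_deriv_def)
  then show ?thesis by blast
qed

text \<open>For \<open>\<eta> < 1\<close> the truncation only discards values \<open>ln \<bar>r' x\<bar> \<le> 0\<close>. The logarithm is integrable because an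
  integral with nonzero value is one of an integrable function.\<close>

lemma integral_trunc_log_deriv_ge:
  assumes "0 < \<eta>" "\<eta> < 1" and pos: "(\<integral>x. ln \<bar>r' x\<bar> \<partial>\<pi>) > 0"
  shows "(\<integral>x. ln \<bar>r' x\<bar> \<partial>\<pi>) \<le> (\<integral>x. trunc_log_deriv \<eta> x \<partial>\<pi>)"
proof (rule integral_mono)
  show "integrable \<pi> (\<lambda>x. ln \<bar>r' x\<bar>)"
    using pos not_integrable_integral_eq by fastforce
  obtain B where "\<And>x. \<bar>trunc_log_deriv \<eta> x\<bar> \<le> B" using trunc_log_deriv_bounded[OF assms(1)] by blast
  then show "integrable \<pi> (trunc_log_deriv \<eta>)"
    by (intro \<pi>.integrable_const_bound[where B=B]) auto
  fix x
  show "ln \<bar>r' x\<bar> \<le> trunc_log_deriv \<eta> x"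
    using assms by (cases "r' x = 0") (auto simp: trunc_log_deriv_def not_less)
qed

text \<open>If \<open>\<bar>r' x\<bar> > \<eta>\<close>, the difference quotient is a value of \<open>\<bar>r'\<bar>\<close> at a nearby point, so it is at least
  \<open>e\<^sup>-\<^sup>\<kappa> \<bar>r' x\<bar>\<close>. Otherwise the truncated logarithm is \<open>0\<close> and the critical loss absorbs the negative part of
  the logarithm.\<close>

lemma ln_diff_quot_ge:
  assumes \<eta>: "\<eta> > 0" and \<kappa>: "\<kappa> > 0" and \<delta>: "\<delta> > 0"
  shows "\<exists>d>0. \<forall>x y. x \<noteq> y \<longrightarrow> r x \<noteq> r y \<longrightarrow> \<bar>x - y\<bar> < d \<longrightarrow>
    trunc_log_deriv \<eta> x - \<kappa> \<le> ln (diff_quot r x y) + enn2real (critical_loss \<eta> \<delta> x y)"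
proof -
  \<comment> \<open>An error of at most \<open>\<gamma>\<close> in \<open>\<bar>r'\<bar>\<close> is a relative error of at most \<open>1 - exp (- \<kappa>)\<close> where \<open>\<bar>r'\<bar> > \<eta>\<close>.\<close>
  define \<gamma> where "\<gamma> = \<eta> * (1 - exp (- \<kappa>))"
  have "\<gamma> > 0" using \<eta> \<kappa> by (simp add: \<gamma>_def)
  then obtain d where d: "d > 0" "\<And>x y. \<bar>x - y\<bar> < d \<Longrightarrow> \<bar>r' x - r' y\<bar> < \<gamma>"
    using r'_ucont unfolding uniformly_continuous_on_def dist_real_def by (metis UNIV_I)
  have "trunc_log_deriv \<eta> x - \<kappa> \<le> ln (diff_quot r x y) + enn2real (critical_loss \<eta> \<delta> x y)"
    if ne: "x \<noteq> y" "r x \<noteq> r y" and close: "\<bar>x - y\<bar> < min d \<delta>" for x y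
  proof -
    have q: "diff_quot r x y = \<bar>r x - r y\<bar> / \<bar>x - y\<bar>" using ne by (simp add: diff_quot_def)
    then have qpos: "diff_quot r x y > 0" using ne by simp
    show ?thesis
    proof (cases "\<bar>r' x\<bar> > \<eta>")
      case True
      have "\<exists>w. \<bar>w - x\<bar> < d \<and> \<bar>r x - r y\<bar> = \<bar>x - y\<bar> * \<bar>r' w\<bar>"
      proof (cases "x < y")
        case True
        obtain w where "x < w" "w < y" "r y - r x = (y - x) * r' w"
          using MVT2[OF True, of r r'] r_deriv by auto
        then show ?thesis
          using close by (intro exI[of _ w]) (auto simp: abs_mult abs_minus_commute[of "r x"] abs_minus_commute[of x y])
      next
        case False
        then have "y < x" using ne by simp
        then obtain w where "y < w" "w < x" "r x - r y = (x - y) * r' w"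
          using MVT2[of y x r r'] r_deriv by auto
        then show ?thesis
          using close by (intro exI[of _ w]) (auto simp: abs_mult)
      qed
      then obtain w where w: "\<bar>w - x\<bar> < d" "\<bar>r x - r y\<bar> = \<bar>x - y\<bar> * \<bar>r' w\<bar>" by blast
      have "\<bar>r' w - r' x\<bar> < \<gamma>" using d(2) w(1) by blast
      then have "\<bar>r' w\<bar> \<ge> \<bar>r' x\<bar> - \<gamma>" by linarith
      moreover have "\<gamma> \<le> \<bar>r' x\<bar> * (1 - exp (- \<kappa>))"
        unfolding \<gamma>_def using True \<kappa> by (intro mult_right_mono) auto
      ultimately have "\<bar>r' x\<bar> * exp (- \<kappa>) \<le> \<bar>r' w\<bar>" by (simp add: algebra_simps)
      moreover have "diff_quot r x y = \<bar>r' w\<bar>" using w(2) ne by (simp add: q)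
      ultimately have "ln (\<bar>r' x\<bar> * exp (- \<kappa>)) \<le> ln (diff_quot r x y)"
        using True \<eta> qpos by (subst ln_le_cancel_iff) auto
      then have "ln \<bar>r' x\<bar> - \<kappa> \<le> ln (diff_quot r x y)"
        using True \<eta> by (cases "r' x = 0") (simp_all add: ln_mult)
      moreover have "0 \<le> enn2real (critical_loss \<eta> \<delta> x y)" by simp
      moreover have "trunc_log_deriv \<eta> x = ln \<bar>r' x\<bar>" using True by (simp add: trunc_log_deriv_def)
      ultimately show ?thesis by linarith
    next
      case False
      then have "critical_loss \<eta> \<delta> x y = ennreal (max (- ln (diff_quot r x y)) 0)"
        using close qpos by (simp add: critical_loss_def log_minus_pos)
      then have "enn2real (critical_loss \<eta> \<delta> x y) = max (- ln (diff_quot r x y)) 0"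
        by (simp only: enn2real_ennreal max.cobounded2)
      then show ?thesis using False \<kappa> by (simp add: trunc_log_deriv_def)
    qed
  qed
  moreover have "min d \<delta> > 0" using d(1) \<delta> by simp
  ultimately show ?thesis by blast
qed

text \<open>Telescoping \<open>ln \<bar>D\<^sub>t\<^sub>+\<^sub>1\<bar> = ln \<bar>D\<^sub>t\<bar> + ln Q\<^sub>t\<close> from a time after which the distance stays below the
  threshold of the one-step bound and below \<open>1\<close>. One \<open>\<kappa> n\<close> pays for the one-step errors, the other for
  the finitely many initial terms and \<open>ln \<bar>D\<^sub>N\<bar>\<close>.\<close>

lemma critical_losses_pay_for_expansion:
  fixes x y :: "nat \<Rightarrow> real" and \<kappa> :: real
  assumes \<eta>: "\<eta> > 0" and \<kappa>: "\<kappa> > 0" and \<delta>: "\<delta> > 0"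
    and step: "\<And>t. t \<ge> 1 \<Longrightarrow> x (Suc t) - y (Suc t) = r (x t) - r (y t)"
    and ne: "\<And>t. t \<ge> 1 \<Longrightarrow> x t \<noteq> y t" and conv: "(\<lambda>t. x t - y t) \<longlonglongrightarrow> 0"
  shows "\<exists>m. \<forall>n\<ge>m. ennreal ((\<Sum>t<n. trunc_log_deriv \<eta> (x t)) - 2 * \<kappa> * real n)
    \<le> (\<Sum>t=2..<n. critical_loss \<eta> \<delta> (x t) (y t))"
proof -
  define g where "g t = trunc_log_deriv \<eta> (x t)" for t
  define q where "q t = diff_quot r (x t) (y t)" for t
  define z where "z t = enn2real (critical_loss \<eta> \<delta> (x t) (y t))" for t
  define D where "D t = \<bar>x t - y t\<bar>" for t
  have rne: "r (x t) \<noteq> r (y t)" if "t \<ge> 1" for t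
    using step[OF that] ne[of "Suc t"] by auto
  have D0: "D t > 0" if "t \<ge> 1" for t using ne[OF that] by (simp add: D_def)
  have q0: "q t > 0" if "t \<ge> 1" for t
    using ne[OF that] rne[OF that] by (simp add: q_def diff_quot_def)
  have Dq: "D (Suc t) = q t * D t" if "t \<ge> 1" for t
    using ne[OF that] step[OF that] by (simp add: D_def q_def diff_quot_def)
  have z: "critical_loss \<eta> \<delta> (x t) (y t) = ennreal (z t)" if "t \<ge> 1" for t
    using q0[OF that] unfolding z_def q_def critical_loss_def
    by (subst ennreal_enn2real) (auto simp: log_minus_pos)
  have z0: "z t \<ge> 0" for t by (simp add: z_def)
  obtain d where d: "d > 0" "\<And>x y. x \<noteq> y \<Longrightarrow> r x \<noteq> r y \<Longrightarrow> \<bar>x - y\<bar> < d \<Longrightarrow>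
    trunc_log_deriv \<eta> x - \<kappa> \<le> ln (diff_quot r x y) + enn2real (critical_loss \<eta> \<delta> x y)"
    using ln_diff_quot_ge[OF \<eta> \<kappa> \<delta>] by blast
  have "eventually (\<lambda>t. D t < min d 1) sequentially"
    unfolding D_def using d(1) tendsto_rabs_zero[OF conv] by (intro order_tendstoD) auto
  then obtain N0 where "\<And>t. t \<ge> N0 \<Longrightarrow> D t < min d 1" unfolding eventually_sequentially by blast
  then obtain N where N: "N \<ge> 2" "\<And>t. t \<ge> N \<Longrightarrow> D t < d" "\<And>t. t \<ge> N \<Longrightarrow> D t < 1"
    using that[of "max N0 2"] by auto
  define c where "c = (\<Sum>t<N. g t) - ln (D N)"
  obtain m0 :: nat where m0: "c / \<kappa> \<le> real m0" using real_arch_simple by blast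
  have "(\<Sum>t<n. g t) - 2 * \<kappa> * real n \<le> (\<Sum>t=2..<n. z t)" if n: "n \<ge> max N m0" for n
  proof -
    have "N \<le> n" using n by simp
    then have "ln (D N) + (\<Sum>t=N..<n. g t - \<kappa> - z t) \<le> ln (D n)"
    proof (induction n rule: dec_induct)
      case (step k)
      have k: "k \<ge> 1" using step N by simp
      have "g k - \<kappa> \<le> ln (q k) + z k"
        unfolding g_def q_def z_def using N(2)[of k] step k by (intro d(2) ne rne) (auto simp: D_def)
      moreover have "ln (D (Suc k)) = ln (q k) + ln (D k)"
        unfolding Dq[OF k] using q0[OF k] D0[OF k] by (simp add: ln_mult)
      ultimately show ?case using step by simp
    qed simp
    also have "ln (D n) \<le> 0"
      using N(3)[of n] D0[of n] \<open>N \<le> n\<close> N(1) by simp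
    finally have "ln (D N) + (\<Sum>t=N..<n. g t) - \<kappa> * (real n - real N) \<le> (\<Sum>t=N..<n. z t)"
      using \<open>N \<le> n\<close> by (simp add: sum_subtractf mult.commute)
    moreover have "(\<Sum>t=N..<n. z t) \<le> (\<Sum>t=2..<n. z t)"
      using N(1) z0 by (intro sum_mono2) auto
    moreover have "(\<Sum>t<n. g t) = (\<Sum>t<N. g t) + (\<Sum>t=N..<n. g t)"
      using \<open>N \<le> n\<close> by (simp add: lessThan_atLeast0 sum.atLeastLessThan_concat)
    moreover have "c \<le> \<kappa> * real n"
    proof -
      have "c / \<kappa> \<le> real n" using m0 n by simp
      then show ?thesis using \<kappa> by (simp add: divide_le_eq mult.commute)
    qed
    moreover have "\<kappa> * (real n - real N) \<le> \<kappa> * real n" using \<kappa> by simp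
    ultimately show ?thesis
      using \<open>N \<le> n\<close> unfolding c_def by (simp add: of_nat_diff)
  qed
  moreover have "(\<Sum>t=2..<n. critical_loss \<eta> \<delta> (x t) (y t)) = ennreal (\<Sum>t=2..<n. z t)" for n
    using z0 z by (subst sum_ennreal[symmetric]) auto
  ultimately show ?thesis
    unfolding g_def by (intro exI[of _ "max N m0"]) (auto intro: ennreal_leI)
qed

end

section \<open>Trajectories do not converge to each other\<close>

context coupled_chains
begin

text \<open>On the event, for all large \<open>n\<close> either the averages of the truncated logarithm deviate from their
  mean (\<open>F n\<close>, of probability \<open>O (1 / n)\<close>) or the losses are large (\<open>G n\<close>, of probability at most
  \<open>2 s / \<lambda>\<close>). An event that forces \<open>F n \<union> G n\<close> for all large \<open>n\<close> has probability at most the limit of these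
  bounds, so convergence in probability of the averages is what the argument rests on.\<close>

lemma prob_tendsto_zero_le:
  assumes crit: "AE x in lborel. r' x \<noteq> 0"
    and pos: "(\<integral>x. ln \<bar>r' x\<bar> \<partial>\<pi>) > 0" (is "?L > 0")
    and \<eta>: "0 < \<eta>" "\<eta> < 1" and \<delta>: "\<delta> > 0" and s: "s \<ge> 0"
    and loss: "\<And>t. t \<ge> 2 \<Longrightarrow> (\<integral>\<^sup>+\<omega>. critical_loss \<eta> \<delta> (X t \<omega>) (Y t \<omega>) \<partial>M) \<le> ennreal s"
  shows "prob {\<omega>\<in>space M. (\<lambda>n. X n \<omega> - Y n \<omega>) \<longlonglongrightarrow> 0} \<le> 2 * s / ?L"
proof -
  \<comment> \<open>Of the growth \<open>6 \<kappa> n\<close>, the pathwise error takes \<open>2 \<kappa> n\<close> and the deviation of the averages \<open>\<kappa> n\<close>; half is left.\<close>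
  define \<kappa> where "\<kappa> = ?L / 6"
  have \<kappa>: "\<kappa> > 0" using pos by (simp add: \<kappa>_def)
  define \<mu> where "\<mu> = (\<integral>x. trunc_log_deriv \<eta> x \<partial>\<pi>)"
  have \<mu>: "?L \<le> \<mu>" unfolding \<mu>_def by (rule integral_trunc_log_deriv_ge[OF \<eta> pos])
  define U where "U n \<omega> = (\<Sum>t=2..<n. critical_loss \<eta> \<delta> (X t \<omega>) (Y t \<omega>))" for n \<omega>
  have cl[measurable]: "(\<lambda>\<omega>. critical_loss \<eta> \<delta> (X t \<omega>) (Y t \<omega>)) \<in> borel_measurable M" for t
    unfolding critical_loss_def diff_quot_def by measurable
  have [measurable]: "U n \<in> borel_measurable M" for n unfolding U_def[abs_def] by measurable
  define F where "F n = {\<omega>\<in>space M. \<bar>(\<Sum>t<n. trunc_log_deriv \<eta> (X t \<omega>)) - real n * \<mu>\<bar> \<ge> real n * \<kappa>}" for n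
  define G where "G n = {\<omega>\<in>space M. ennreal (real n * (?L / 2)) \<le> U n \<omega>}" for n
  have [measurable]: "F n \<in> sets M" "G n \<in> sets M" for n unfolding F_def G_def by measurable
  obtain B where B: "\<And>x. \<bar>trunc_log_deriv \<eta> x\<bar> \<le> B" using trunc_log_deriv_bounded[OF \<eta>(1)] by blast
  obtain C where C: "\<And>n. n > 0 \<Longrightarrow> prob (F n) \<le> C / real n"
    using X_law_of_large_numbers[OF trunc_log_deriv_measurable B \<kappa>] unfolding F_def \<mu>_def by blast
  have G: "prob (G n) \<le> 2 * s / ?L" if n: "n > 0" for n
  proof -
    define a where "a = real n * (?L / 2)"
    have a: "a > 0" using n pos by (simp add: a_def)
    have "emeasure M {\<omega>\<in>space M. 1 \<le> ennreal (1 / a) * U n \<omega>} \<le> ennreal (1 / a) * (\<integral>\<^sup>+\<omega>. U n \<omega> * indicator (space M) \<omega> \<partial>M)"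
      by (rule nn_integral_Markov_inequality) auto
    also have "(\<integral>\<^sup>+\<omega>. U n \<omega> * indicator (space M) \<omega> \<partial>M) = (\<Sum>t=2..<n. \<integral>\<^sup>+\<omega>. critical_loss \<eta> \<delta> (X t \<omega>) (Y t \<omega>) \<partial>M)"
      unfolding U_def by (subst nn_integral_sum[symmetric]) (auto intro!: nn_integral_cong)
    also have "\<dots> \<le> (\<Sum>t=2..<n. ennreal s)" by (intro sum_mono loss) auto
    also have "\<dots> \<le> ennreal (real n * s)"
      using s by (simp add: ennreal_of_nat_eq_real_of_nat ennreal_mult[symmetric] mult_right_mono)
    also have "ennreal (1 / a) * ennreal (real n * s) = ennreal (2 * s / ?L)"
      using n pos s unfolding a_def by (subst ennreal_mult[symmetric]) (auto simp: field_simps)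
    finally have "emeasure M {\<omega>\<in>space M. 1 \<le> ennreal (1 / a) * U n \<omega>} \<le> ennreal (2 * s / ?L)"
      by (simp add: mult_left_mono)
    moreover have "G n \<subseteq> {\<omega>\<in>space M. 1 \<le> ennreal (1 / a) * U n \<omega>}"
    proof (unfold G_def a_def[symmetric], safe)
      fix \<omega> assume "ennreal a \<le> U n \<omega>"
      then have "ennreal (1 / a) * ennreal a \<le> ennreal (1 / a) * U n \<omega>" by (rule mult_left_mono) simp
      then show "1 \<le> ennreal (1 / a) * U n \<omega>"
        using a by (simp add: ennreal_mult[symmetric] del: ennreal_mult')
    qed
    then have "emeasure M (G n) \<le> emeasure M {\<omega>\<in>space M. 1 \<le> ennreal (1 / a) * U n \<omega>}"
      by (rule emeasure_mono) measurable
    ultimately have "emeasure M (G n) \<le> ennreal (2 * s / ?L)" by simp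
    then show ?thesis using s pos by (simp add: emeasure_eq_measure)
  qed
  define H where "H m = (\<Inter>n\<in>{m..}. F n \<union> G n)" for m
  have [measurable]: "H m \<in> sets M" for m unfolding H_def by measurable
  have H: "prob (H m) \<le> 2 * s / ?L" for m
  proof (rule LIMSEQ_le_const)
    show "(\<lambda>n. C / real n + 2 * s / ?L) \<longlonglongrightarrow> 2 * s / ?L"
      using tendsto_add[OF lim_const_over_n[of C] tendsto_const[of "2 * s / ?L"]] by simp
    have "prob (H m) \<le> C / real n + 2 * s / ?L" if n: "n \<ge> max m 1" for n
    proof -
      have "prob (H m) \<le> prob (F n \<union> G n)"
        using n by (intro finite_measure_mono) (auto simp: H_def)
      also have "\<dots> \<le> prob (F n) + prob (G n)" by (rule measure_Un_le) auto
      also have "\<dots> \<le> C / real n + 2 * s / ?L" using n by (intro add_mono C G) auto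
      finally show ?thesis .
    qed
    then show "\<exists>k. \<forall>n\<ge>k. prob (H m) \<le> C / real n + 2 * s / ?L" by blast
  qed
  have "prob {\<omega>\<in>space M. (\<lambda>n. X n \<omega> - Y n \<omega>) \<longlonglongrightarrow> 0} \<le> prob (\<Union>m. H m)"
  proof (rule finite_measure_mono_AE)
    show "AE \<omega> in M. \<omega> \<in> {\<omega>\<in>space M. (\<lambda>n. X n \<omega> - Y n \<omega>) \<longlonglongrightarrow> 0} \<longrightarrow> \<omega> \<in> (\<Union>m. H m)"
      using AE_never_meet[OF crit]
    proof (eventually_elim, intro impI)
      fix \<omega> assume ne: "\<forall>t\<ge>1. X t \<omega> \<noteq> Y t \<omega>"
        and \<omega>: "\<omega> \<in> {\<omega>\<in>space M. (\<lambda>n. X n \<omega> - Y n \<omega>) \<longlonglongrightarrow> 0}"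
      have "\<exists>m. \<forall>n\<ge>m. ennreal ((\<Sum>t<n. trunc_log_deriv \<eta> (X t \<omega>)) - 2 * \<kappa> * real n) \<le> U n \<omega>"
        unfolding U_def using \<omega> ne
        by (intro critical_losses_pay_for_expansion \<eta> \<kappa> \<delta>) (auto simp: X_Suc Y_Suc)
      then obtain m where m: "\<And>n. n \<ge> m \<Longrightarrow> ennreal ((\<Sum>t<n. trunc_log_deriv \<eta> (X t \<omega>)) - 2 * \<kappa> * real n) \<le> U n \<omega>"
        by blast
      have "\<omega> \<in> F n \<union> G n" if "n \<ge> m" for n
      proof (cases "\<omega> \<in> F n")
        case False
        then have "real n * \<mu> - real n * \<kappa> \<le> (\<Sum>t<n. trunc_log_deriv \<eta> (X t \<omega>))"
          using \<omega> by (auto simp: F_def)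
        moreover have "real n * ?L \<le> real n * \<mu>" using \<mu> by (simp add: mult_left_mono)
        moreover have "real n * (?L / 2) = 3 * (real n * \<kappa>)" "real n * ?L = 6 * (real n * \<kappa>)"
            "2 * \<kappa> * real n = 2 * (real n * \<kappa>)"
          by (simp_all add: \<kappa>_def)
        ultimately have "real n * (?L / 2) \<le> (\<Sum>t<n. trunc_log_deriv \<eta> (X t \<omega>)) - 2 * \<kappa> * real n"
          by linarith
        then have "ennreal (real n * (?L / 2)) \<le> U n \<omega>"
          using m[OF that] by (meson ennreal_leI order_trans)
        then show ?thesis using \<omega> by (simp add: G_def)
      qed simp
      then show "\<omega> \<in> (\<Union>m. H m)" by (auto simp: H_def)
    qed
  qed measurable
  also have "\<dots> \<le> 2 * s / ?L"
  proof (rule LIMSEQ_le_const2)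
    show "(\<lambda>m. prob (H m)) \<longlonglongrightarrow> prob (\<Union>m. H m)"
      by (rule finite_Lim_measure_incseq) (auto simp: H_def incseq_def)
  qed (use H in auto)
  finally show ?thesis .
qed

lemma AE_not_tendsto_zero:
  assumes crit: "AE x in lborel. r' x \<noteq> 0"
    and pos: "(\<integral>x. ln \<bar>r' x\<bar> \<partial>\<pi>) > 0" (is "?L > 0")
    and \<delta>: "\<delta> > 0"
    and loss: "((\<lambda>\<eta>. SUP t\<in>{2..}. \<integral>\<^sup>+\<omega>. critical_loss \<eta> \<delta> (X t \<omega>) (Y t \<omega>) \<partial>M) \<longlongrightarrow> 0) (at_right 0)"
  shows "AE \<omega> in M. \<not> (\<lambda>n. X n \<omega> - Y n \<omega>) \<longlonglongrightarrow> 0"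
proof -
  let ?A = "{\<omega>\<in>space M. (\<lambda>n. X n \<omega> - Y n \<omega>) \<longlonglongrightarrow> 0}"
  have "prob ?A \<le> 0 + e" if e: "e > 0" for e
  proof -
    define s where "s = e * ?L / 2"
    have s: "s > 0" using e pos by (simp add: s_def)
    have "eventually (\<lambda>\<eta>. (SUP t\<in>{2..}. \<integral>\<^sup>+\<omega>. critical_loss \<eta> \<delta> (X t \<omega>) (Y t \<omega>) \<partial>M) < ennreal s) (at_right 0)"
      using loss s by (intro order_tendstoD(2)) auto
    moreover have "eventually (\<lambda>\<eta>::real. 0 < \<eta> \<and> \<eta> < 1) (at_right 0)"
      by (rule eventually_at_rightI[of 0 1]) auto
    ultimately have "eventually (\<lambda>\<eta>::real. (0 < \<eta> \<and> \<eta> < 1) \<and>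
        (SUP t\<in>{2..}. \<integral>\<^sup>+\<omega>. critical_loss \<eta> \<delta> (X t \<omega>) (Y t \<omega>) \<partial>M) < ennreal s) (at_right 0)"
      by eventually_elim simp
    then obtain \<eta> where \<eta>: "0 < \<eta>" "\<eta> < 1"
      and sup: "(SUP t\<in>{2..}. \<integral>\<^sup>+\<omega>. critical_loss \<eta> \<delta> (X t \<omega>) (Y t \<omega>) \<partial>M) < ennreal s"
      using eventually_happens[of _ "at_right (0::real)"] by (auto simp: trivial_limit_at_right_real)
    have "(\<integral>\<^sup>+\<omega>. critical_loss \<eta> \<delta> (X t \<omega>) (Y t \<omega>) \<partial>M) \<le> ennreal s" if "t \<ge> 2" for t
      using sup that by (intro order_trans[OF SUP_upper less_imp_le]) auto
    from prob_tendsto_zero_le[OF crit pos \<eta> \<delta> less_imp_le[OF s] this]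
    show ?thesis using pos by (simp add: s_def)
  qed
  then have "prob ?A \<le> 0" by (rule field_le_epsilon)
  then have "prob ?A = 0" by (simp add: measure_le_0_iff)
  moreover have "?A \<in> sets M" by measurable
  ultimately have "AE \<omega> in M. \<omega> \<notin> ?A" by (intro AE_not_in) (auto simp: null_sets_def emeasure_eq_measure)
  then show ?thesis using AE_space by eventually_elim simp
qed

end

theorem theorem3p1:
  fixes M :: "'a measure"
    and r r' f\<^sub>\<epsilon> :: "real \<Rightarrow> real"
    and X0 \<epsilon>1' :: "'a \<Rightarrow> real"
    and \<epsilon> X X' D Q :: "nat \<Rightarrow> 'a \<Rightarrow> real"
    and \<pi> :: "real measure"
    and \<delta>0 :: real
  defines "X \<equiv> (\<lambda>t \<omega>. chain r (X0 \<omega>) (\<lambda>s. \<epsilon> s \<omega>) t)"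
    and "X' \<equiv> (\<lambda>t \<omega>. coupled_chain r (X0 \<omega>) (\<epsilon>1' \<omega>) (\<lambda>s. \<epsilon> s \<omega>) t)"
    and "D \<equiv> (\<lambda>t \<omega>. X t \<omega> - X' t \<omega>)"
    and "Q \<equiv> (\<lambda>t \<omega>. diff_quot r (X t \<omega>) (X' t \<omega>))"
  assumes "prob_space M"
    and "bounded (range r)"
    and "\<And>x. (r has_real_derivative r' x) (at x)"
    and "bounded (range r')"
    and "uniformly_continuous_on UNIV r'"
    and "\<And>t. t \<ge> 1 \<Longrightarrow> distributed M lborel (\<epsilon> t) (\<lambda>x. ennreal (f\<^sub>\<epsilon> x))"
    and "prob_space.indep_vars M (\<lambda>_. borel) \<epsilon> {1..}"
    and "\<And>x. f\<^sub>\<epsilon> x > 0"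
    and "\<And>a b. a \<le> b \<Longrightarrow> \<exists>c>0. \<forall>x\<in>{a..b}. c \<le> f\<^sub>\<epsilon> x"
    and "invariant_prob (ar_kernel r f\<^sub>\<epsilon>) \<pi>"
    and "X0 \<in> borel_measurable M" and "distr M borel X0 = \<pi>"
    and "prob_space.indep_set M (sigma_gen M X0 borel)
           (sigma_gen M (\<lambda>\<omega>. \<lambda>t\<in>{1..}. \<epsilon> t \<omega>) (PiM {1..} (\<lambda>_. borel)))"
    and "\<epsilon>1' \<in> borel_measurable M" and "distr M borel \<epsilon>1' = distr M borel (\<epsilon> 1)"
    and "prob_space.indep_set M (sigma_gen M \<epsilon>1' borel)
           (sigma_gen M (\<lambda>\<omega>. (X0 \<omega>, \<lambda>t\<in>{1..}. \<epsilon> t \<omega>)) (borel \<Otimes>\<^sub>M PiM {1..} (\<lambda>_. borel)))"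
    and "(\<integral>\<omega>. ln \<bar>r' (X0 \<omega>)\<bar> \<partial>M) > 0"
    and "(\<integral>\<^sup>+ \<omega>. log_minus \<bar>r' (X0 \<omega>)\<bar> \<partial>M) < \<infinity>"
    and "\<delta>0 > 0"
    and "((\<lambda>\<eta>. SUP t\<in>{2..}. \<integral>\<^sup>+ \<omega>. log_minus (Q t \<omega>) *
              indicator {\<omega>. \<bar>r' (X t \<omega>)\<bar> \<le> \<eta> \<and> \<bar>D t \<omega>\<bar> \<le> \<delta>0} \<omega> \<partial>M) \<longlongrightarrow> 0) (at_right 0)"
  shows "({\<omega>\<in>space M. (\<lambda>n. D n \<omega>) \<longlonglongrightarrow> 0} \<in> sets M \<and>
          measure M {\<omega>\<in>space M. (\<lambda>n. D n \<omega>) \<longlonglongrightarrow> 0} = 0) \<and>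
         (AE (x, y) in (lborel :: (real \<times> real) measure).
            {\<omega>\<in>space M. (\<lambda>n. \<bar>flow r (\<lambda>s. \<epsilon> s \<omega>) n x - flow r (\<lambda>s. \<epsilon> s \<omega>) n y\<bar>) \<longlonglongrightarrow> 0} \<in> sets M \<and>
            measure M {\<omega>\<in>space M. (\<lambda>n. \<bar>flow r (\<lambda>s. \<epsilon> s \<omega>) n x - flow r (\<lambda>s. \<epsilon> s \<omega>) n y\<bar>) \<longlonglongrightarrow> 0} = 0)"
proof -
  note asms = assms(5-)
  interpret prob_space M by (rule asms(1))
  note \<epsilon>_law = asms(6) and \<epsilon>_indep = asms(7)
  have \<epsilon>_measurable[measurable]: "\<epsilon> t \<in> borel_measurable M" if "t \<ge> 1" for t
    using distributed_measurable[OF \<epsilon>_law[OF that]] by simp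
  note X0_measurable[measurable] = asms(11) and \<epsilon>1'_measurable[measurable] = asms(14)
  let ?\<nu> = "density lborel (\<lambda>x. ennreal (f\<^sub>\<epsilon> x))"
  have law_\<epsilon>: "distr M borel (\<epsilon> t) = ?\<nu>" if "t \<ge> 1" for t
  proof -
    have "distr M borel (\<epsilon> t) = distr M lborel (\<epsilon> t)" by (rule distr_cong) auto
    then show ?thesis using distributed_distr_eq_density[OF \<epsilon>_law[OF that]] by simp
  qed
  define W where "W = noise_family X0 \<epsilon>1' \<epsilon>"
  have W: "W 0 = X0" "W 1 = \<epsilon>1'" "\<And>n. n \<ge> 2 \<Longrightarrow> W n = \<epsilon> (n - 1)"
    unfolding W_def by (rule noise_family_simps; assumption)+
  have indep_W: "indep_vars (\<lambda>_. borel) W UNIV"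
    unfolding W_def by (rule indep_noise_family[OF X0_measurable \<epsilon>1'_measurable \<epsilon>_indep asms(13,16)])
  have law_W: "distr M borel (W (Suc n)) = ?\<nu>" for n
    using asms(15) law_\<epsilon>[of 1] law_\<epsilon>[of n] by (cases n) (simp_all add: W_def noise_family_def law_\<epsilon>)
  have "distr M borel (W 0) = \<pi>" by (simp add: W(1) asms(12))
  moreover have "prob_space ?\<nu>"
    unfolding law_\<epsilon>[OF order_refl, symmetric] by (rule prob_space_distr) simp
  moreover have "(\<lambda>x. ennreal (f\<^sub>\<epsilon> x)) \<in> borel_measurable borel"
    using distributed_borel_measurable[OF \<epsilon>_law[OF order_refl]] by simp
  ultimately interpret cc: coupled_chains r r' f\<^sub>\<epsilon> \<pi> M W
    by (intro coupled_chains.intro ar_model.intro coupled_chains_axioms.intro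
        asms(1-5,8-10) indep_W law_W)
  have X: "X t \<omega> = cc.X t \<omega>" for t \<omega>
    unfolding X_def cc.X_def W(1) by (rule chain_cong) (simp add: W(3))
  have X': "X' t \<omega> = cc.Y t \<omega>" for t \<omega>
    unfolding X'_def cc.Y_def W(1,2) by (rule coupled_chain_cong) (simp add: W(3))
  have flow: "flow r (\<lambda>s. \<epsilon> s \<omega>) n x = flow r (cc.noise \<omega>) n x" for \<omega> n x
    by (rule flow_cong) (simp add: W(3))
  \<comment> \<open>A finite integral of \<open>log_minus\<close> forces \<open>r' (X\<^sub>0) \<noteq> 0\<close> almost surely, and \<open>\<pi>\<close> dominates Lebesgue measure.\<close>
  have "AE \<omega> in M. log_minus \<bar>r' (X0 \<omega>)\<bar> \<noteq> \<infinity>"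
    using asms(18) by (intro nn_integral_PInf_AE) auto
  then have "AE \<omega> in M. r' (X0 \<omega>) \<noteq> 0"
    by eventually_elim (auto simp: log_minus_def)
  then have "AE x in \<pi>. r' x \<noteq> 0"
    unfolding asms(12)[symmetric] by (subst AE_distr_iff) auto
  then have crit: "AE x in lborel. r' x \<noteq> 0" by (rule cc.lborel_absolutely_continuous)
  have pos: "(\<integral>x. ln \<bar>r' x\<bar> \<partial>\<pi>) > 0"
    unfolding asms(12)[symmetric] using asms(17) by (subst integral_distr) auto
  have "log_minus (Q t \<omega>) * indicator {\<omega>. \<bar>r' (X t \<omega>)\<bar> \<le> \<eta> \<and> \<bar>D t \<omega>\<bar> \<le> \<delta>0} \<omega>
      = cc.critical_loss \<eta> \<delta>0 (cc.X t \<omega>) (cc.Y t \<omega>)" for t \<omega> \<eta>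
    by (simp add: Q_def D_def X X' cc.critical_loss_def)
  then have AE: "AE \<omega> in M. \<not> (\<lambda>n. cc.X n \<omega> - cc.Y n \<omega>) \<longlonglongrightarrow> 0"
    using asms(20) by (intro cc.AE_not_tendsto_zero[OF crit pos asms(19)]) simp
  have null: "measure M {\<omega>\<in>space M. P \<omega>} = 0"
    if "{\<omega>\<in>space M. P \<omega>} \<in> sets M" "AE \<omega> in M. \<not> P \<omega>" for P
  proof -
    have "{\<omega>\<in>space M. P \<omega>} \<in> null_sets M"
      using that by (subst AE_iff_null_sets) auto
    then show ?thesis by (rule measure_eq_0_null_sets)
  qed
  have meas: "{\<omega>\<in>space M. (\<lambda>n. D n \<omega>) \<longlonglongrightarrow> 0} \<in> sets M"
    unfolding D_def X X' by measurable
  have meas_flow: "{\<omega>\<in>space M. (\<lambda>n. \<bar>flow r (cc.noise \<omega>) n x - flow r (cc.noise \<omega>) n y\<bar>) \<longlonglongrightarrow> 0} \<in> sets M" for x y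
    unfolding pred_def[symmetric]
    by (intro pred_tendsto_zero borel_measurable_abs borel_measurable_diff flow_measurable) measurable
  show ?thesis
  proof (intro conjI)
    show "measure M {\<omega>\<in>space M. (\<lambda>n. D n \<omega>) \<longlonglongrightarrow> 0} = 0"
      by (rule null[OF meas]) (use AE in \<open>simp add: D_def X X'\<close>)
    show "AE (x, y) in lborel.
        {\<omega>\<in>space M. (\<lambda>n. \<bar>flow r (\<lambda>s. \<epsilon> s \<omega>) n x - flow r (\<lambda>s. \<epsilon> s \<omega>) n y\<bar>) \<longlonglongrightarrow> 0} \<in> sets M \<and>
        measure M {\<omega>\<in>space M. (\<lambda>n. \<bar>flow r (\<lambda>s. \<epsilon> s \<omega>) n x - flow r (\<lambda>s. \<epsilon> s \<omega>) n y\<bar>) \<longlonglongrightarrow> 0} = 0"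
      using cc.AE_flow_if_AE_coupled[OF AE]
    proof eventually_elim
      case (elim z)
      show ?case
        unfolding flow case_prod_beta using meas_flow null[OF meas_flow elim] by simp
    qed
  qed (rule meas)
qed

end
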